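(* Assume that $f:\mathbb{R}^n\to\overline{\mathbb{R}}$ is prox-regular, subdifferentially continuous and twice epi-differentiable at $\bar x$ for $0$. Consider the following conditions: (i) $f$ satisfies the quadratic growth condition at $\bar x$. (ii) $d^2f(\bar x\mid0)(w)>0$ holds for all $w\neq0$. (iii) $C:=\{w\in\mathbb{R}^n\mid d^2f(\bar x\mid0)(w)\le1\}$ is bounded. (iv) $D(\partial f)(\bar x\mid0)$ is positive definite. (v) $[D(\partial f)(\bar x\mid0)]^{-1}(0)=\{0\}$, i.e. $D(\partial f)(\bar x\mid0)$ is nonsingular. Then (i) $\Leftrightarrow$ (ii) $\Leftrightarrow$ (iii) $\Leftrightarrow$ (iv) $\Rightarrow$ (v), and all the conditions are equivalent if $f$ is convex. If one of conditions (i)–(iv) is satisfied, then $f$ satisfies the KL property at $\bar x$ with exponent $\frac12$, which is sharp if $\operatorname{dom}[D(\partial f)(\bar x\mid0)]\neq\{0\}$, or in other words $C\neq\{0\}$.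
   Context: $\overline{\mathbb{R}}=\mathbb{R}\cup\{\pm\infty\}$; $\mathbb{B}_\epsilon(\bar x)$ is the closed ball; $d(v,A)=\inf_{a\in A}\|a-v\|$ with $d(v,\emptyset)=+\infty$. A function finite at $\bar x$ is locally lsc at $\bar x$ if its epigraph is locally closed at $(\bar x,f(\bar x))$. Subgradients. Let $f(x)$ be finite. $v\in\widehat\partial f(x)$ if $f(y)\ge f(x)+\langle v,y-x\rangle+o(\|y-x\|)$. $v\in\partial f(x)$ (limiting) if there are $x_k\to x$, $v_k\to v$ with $f(x_k)\to f(x)$, $v_k\in\widehat\partial f(x_k)$. Subdifferentials are empty where $f$ is not finite. Prox-regularity at $\bar x$ for $\bar v$: $f$ is finite and locally lsc at $\bar x$, $\bar v\in\partial f(\bar x)$, and there are $\epsilon>0$, $\rho\ge0$ such that $f(x')\ge f(x)+\langle v,x'-x\rangle-\frac\rho2\|x'-x\|^2$ for all $x'\in\mathbb{B}_\epsilon(\bar x)$ whenever $v\in\partial f(x)$, $\|v-\bar v\|<\epsilon$, $\|x-\bar x\|<\epsilon$, $f(x)<f(\bar x)+\epsilon$. Subdifferential continuity at $\bar x$ for $\bar v$: $\bar v\in\partial f(\bar x)$ and $(x^\nu,v^\nu)\to(\bar x,\bar v)$ with $v^\nu\in\partial f(x^\nu)$ implies $f(x^\nu)\to f(\bar x)$. Second subderivative: $d^2f(\bar x\mid v)(w):=\liminf_{t\downarrow0,\ w'\to w}\frac{f(\bar x+tw')-f(\bar x)-t\langle v,w'\rangle}{\frac12t^2}$. $f$ is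 twice epi-differentiable at $\bar x$ for $v$ if for every $w$ and every $t^\nu\downarrow0$ there is $w^\nu\to w$ with $d^2f(\bar x\mid v)(w)=\lim_\nu\frac{f(\bar x+t^\nu w^\nu)-f(\bar x)-t^\nu\langle v,w^\nu\rangle}{\frac12(t^\nu)^2}$. Graphical derivative: for $S:\mathbb{R}^n\rightrightarrows\mathbb{R}^m$ and $\bar u\in S(\bar x)$, $z\in DS(\bar x\mid\bar u)(w)$ iff $(w,z)\in T_{\operatorname{gph}S}(\bar x,\bar u)$, where $w\in T_A(x)$ iff there are $t_k\downarrow0$, $w_k\to w$ with $x+t_kw_k\in A$. $DS(\bar x\mid\bar u)$ is positive definite if $\langle v,w\rangle>0$ for all $v\in DS(\bar x\mid\bar u)(w)$ with $w\neq0$. $\operatorname{dom}S=\{x\mid S(x)\neq\emptyset\}$. Quadratic growth condition at $\bar x$: there is $\kappa>0$ with $f(x)\ge f(\bar x)+\frac\kappa2\|x-\bar x\|^2$ for all $x$ close enough to $\bar x$. KL property. $f$ satisfies the KL property at $\bar x$ with exponent $\theta\in[0,1)$ if there exist $\mu>0$, $\epsilon>0$, $\nu\in(0,+\infty]$ such that $d(0,\partial f(x))\ge\frac{\mu}{1-\theta}(f(x)-f(\bar x))^{\theta}$ whenever $\|x-\bar x\|\le\epsilon$ and $f(\bar x)<f(x)<f(\bar x)+\nu$. An exponent $\theta\in(0,1)$ is sharp if $f$ satisfies the KL property at $\bar x$ with exponent $\theta$ but not with any exponent $\theta'\in[0,\theta)$. *)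

theory Defs
  imports "HOL-Analysis.Analysis" "HOL-Library.Landau_Symbols"
begin

text \<open>Extended-real-valued functions are functions into \<^typ>\<open>ereal\<close>; both infinite values are allowed.\<close>

definition finite_at :: "('a \<Rightarrow> ereal) \<Rightarrow> 'a \<Rightarrow> bool"
  where "finite_at f x \<longleftrightarrow> \<bar>f x\<bar> \<noteq> \<infinity>"

text \<open>The library's \<^const>\<open>epigraph\<close> and \<^const>\<open>convex_on\<close> only cover real-valued functions.\<close>

definition epi :: "('a \<Rightarrow> ereal) \<Rightarrow> ('a \<times> real) set"
  where "epi f = {(x, r). f x \<le> ereal r}"

definition convex_fun :: "('a::real_vector \<Rightarrow> ereal) \<Rightarrow> bool"
  where "convex_fun f \<longleftrightarrow> convex (epi f)"

definition locally_closed_at :: "'a::topological_space set \<Rightarrow> 'a \<Rightarrow> bool"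
  where "locally_closed_at A p \<longleftrightarrow> (\<exists>V. closed V \<and> p \<in> interior V \<and> closed (A \<inter> V))"

definition locally_lsc_at :: "('a::topological_space \<Rightarrow> ereal) \<Rightarrow> 'a \<Rightarrow> bool"
  where "locally_lsc_at f x \<longleftrightarrow>
    finite_at f x \<and> locally_closed_at (epi f) (x, real_of_ereal (f x))"

definition regular_subdiff :: "('a::euclidean_space \<Rightarrow> ereal) \<Rightarrow> 'a \<Rightarrow> 'a set"
  where "regular_subdiff f x = {v. finite_at f x \<and>
    (\<exists>r \<in> o[at x](\<lambda>y. norm (y - x)).
      \<forall>\<^sub>F y in at x. f y \<ge> f x + ereal (v \<bullet> (y - x) + r y))}"

definition subdiff :: "('a::euclidean_space \<Rightarrow> ereal) \<Rightarrow> 'a \<Rightarrow> 'a set"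
  where "subdiff f x = {v. finite_at f x \<and>
    (\<exists>X V. X \<longlonglongrightarrow> x \<and> V \<longlonglongrightarrow> v \<and> (\<lambda>k. f (X k)) \<longlonglongrightarrow> f x \<and>
      (\<forall>k. V k \<in> regular_subdiff f (X k)))}"

definition prox_regular :: "('a::euclidean_space \<Rightarrow> ereal) \<Rightarrow> 'a \<Rightarrow> 'a \<Rightarrow> bool"
  where "prox_regular f xb vb \<longleftrightarrow>
    finite_at f xb \<and> locally_lsc_at f xb \<and> vb \<in> subdiff f xb \<and>
    (\<exists>\<epsilon>>0. \<exists>\<rho>\<ge>0. \<forall>x v.
      v \<in> subdiff f x \<and> norm (v - vb) < \<epsilon> \<and> norm (x - xb) < \<epsilon> \<and> f x < f xb + ereal \<epsilon> \<longrightarrow>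
      (\<forall>x' \<in> cball xb \<epsilon>.
        f x' \<ge> f x + ereal (v \<bullet> (x' - x) - \<rho> / 2 * (norm (x' - x))\<^sup>2)))"

definition subdiff_continuous :: "('a::euclidean_space \<Rightarrow> ereal) \<Rightarrow> 'a \<Rightarrow> 'a \<Rightarrow> bool"
  where "subdiff_continuous f xb vb \<longleftrightarrow>
    vb \<in> subdiff f xb \<and>
    (\<forall>X V. X \<longlonglongrightarrow> xb \<and> V \<longlonglongrightarrow> vb \<and> (\<forall>k. V k \<in> subdiff f (X k)) \<longrightarrow>
      (\<lambda>k. f (X k)) \<longlonglongrightarrow> f xb)"

text \<open>The quotient is only used at points where \<open>f\<close> is finite, so the subtractions are unambiguous.\<close>

definition second_quotient ::
  "('a::euclidean_space \<Rightarrow> ereal) \<Rightarrow> 'a \<Rightarrow> 'a \<Rightarrow> real \<Rightarrow> 'a \<Rightarrow> ereal"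
  where "second_quotient f xb v t w =
    (f (xb + t *\<^sub>R w) - f xb - ereal (t * (v \<bullet> w))) / ereal (1 / 2 * t\<^sup>2)"

text \<open>As usual for lower limits of this kind, \<open>w' = w\<close> is admitted, hence \<^term>\<open>nhds w\<close> and not
  \<^term>\<open>at w\<close>.\<close>

definition second_subderiv :: "('a::euclidean_space \<Rightarrow> ereal) \<Rightarrow> 'a \<Rightarrow> 'a \<Rightarrow> 'a \<Rightarrow> ereal"
  where "second_subderiv f xb v w =
    Liminf (at_right 0 \<times>\<^sub>F nhds w) (\<lambda>(t, w'). second_quotient f xb v t w')"

definition twice_epi_differentiable :: "('a::euclidean_space \<Rightarrow> ereal) \<Rightarrow> 'a \<Rightarrow> 'a \<Rightarrow> bool"
  where "twice_epi_differentiable f xb v \<longleftrightarrow>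
    (\<forall>w. \<forall>t :: nat \<Rightarrow> real. (\<forall>k. t k > 0) \<and> t \<longlonglongrightarrow> 0 \<longrightarrow>
      (\<exists>W. W \<longlonglongrightarrow> w \<and>
        (\<lambda>k. second_quotient f xb v (t k) (W k)) \<longlonglongrightarrow> second_subderiv f xb v w))"

definition tangent_cone :: "'a::real_normed_vector set \<Rightarrow> 'a \<Rightarrow> 'a set"
  where "tangent_cone A x = {w. \<exists>(t :: nat \<Rightarrow> real) W.
    (\<forall>k. t k > 0) \<and> t \<longlonglongrightarrow> 0 \<and> W \<longlonglongrightarrow> w \<and> (\<forall>k. x + t k *\<^sub>R W k \<in> A)}"

text \<open>Set-valued mappings are functions into sets.\<close>

definition gph :: "('a \<Rightarrow> 'b set) \<Rightarrow> ('a \<times> 'b) set"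
  where "gph S = {(x, u). u \<in> S x}"

definition dom_map :: "('a \<Rightarrow> 'b set) \<Rightarrow> 'a set"
  where "dom_map S = {x. S x \<noteq> {}}"

definition inverse_map :: "('a \<Rightarrow> 'b set) \<Rightarrow> 'b \<Rightarrow> 'a set"
  where "inverse_map S u = {x. u \<in> S x}"

definition graphical_derivative ::
  "('a::real_normed_vector \<Rightarrow> 'b::real_normed_vector set) \<Rightarrow> 'a \<Rightarrow> 'b \<Rightarrow> 'a \<Rightarrow> 'b set"
  where "graphical_derivative S xb ub w = {z. (w, z) \<in> tangent_cone (gph S) (xb, ub)}"

definition pos_definite_map :: "('a::real_inner \<Rightarrow> 'a set) \<Rightarrow> bool"
  where "pos_definite_map H \<longleftrightarrow> (\<forall>w v. v \<in> H w \<and> w \<noteq> 0 \<longrightarrow> v \<bullet> w > 0)"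

definition quadratic_growth :: "('a::real_normed_vector \<Rightarrow> ereal) \<Rightarrow> 'a \<Rightarrow> bool"
  where "quadratic_growth f xb \<longleftrightarrow>
    (\<exists>\<kappa>>0. \<forall>\<^sub>F x in nhds xb. f x \<ge> f xb + ereal (\<kappa> / 2 * (norm (x - xb))\<^sup>2))"

text \<open>Unlike \<^const>\<open>infdist\<close>, this distance is \<open>\<infinity>\<close> for the empty set.\<close>

definition set_distance :: "'a::real_normed_vector \<Rightarrow> 'a set \<Rightarrow> ereal"
  where "set_distance v A = (INF a\<in>A. ereal (norm (a - v)))"

text \<open>For finite \<^term>\<open>f xb\<close>, the condition \<^term>\<open>f xb < f x \<and> f x < f xb + \<nu>\<close> makes \<^term>\<open>f x - f xb\<close>
  finite and positive, so that \<^const>\<open>real_of_ereal\<close> and \<open>powr\<close> (including exponent \<open>0\<close>) are harmless.\<close>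

definition KL_property :: "('a::euclidean_space \<Rightarrow> ereal) \<Rightarrow> 'a \<Rightarrow> real \<Rightarrow> bool"
  where "KL_property f xb \<theta> \<longleftrightarrow> 0 \<le> \<theta> \<and> \<theta> < 1 \<and>
    (\<exists>\<mu>>0. \<exists>\<epsilon>>0. \<exists>\<nu>::ereal. \<nu> > 0 \<and>
      (\<forall>x. norm (x - xb) \<le> \<epsilon> \<and> f xb < f x \<and> f x < f xb + \<nu> \<longrightarrow>
        set_distance 0 (subdiff f x) \<ge>
          ereal (\<mu> / (1 - \<theta>) * (real_of_ereal (f x - f xb)) powr \<theta>)))"

definition KL_sharp :: "('a::euclidean_space \<Rightarrow> ereal) \<Rightarrow> 'a \<Rightarrow> real \<Rightarrow> bool"
  where "KL_sharp f xb \<theta> \<longleftrightarrow> 0 < \<theta> \<and> \<theta> < 1 \<and>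
    KL_property f xb \<theta> \<and> (\<forall>\<theta>'. 0 \<le> \<theta>' \<and> \<theta>' < \<theta> \<longrightarrow> \<not> KL_property f xb \<theta>')"

end

theory Submission imports Defs begin

text \<open>Write \<open>h = d\<^sup>2f(xb | 0)\<close> and \<open>H = D(\<partial>f)(xb | 0)\<close>. The general theory identifies \<open>H\<close> with
  \<open>\<partial>(h/2)\<close>; two consequences of this identity suffice here, and both have short direct proofs.

  \<^item> Every \<open>z \<in> H w\<close> satisfies \<open>h w = z \<bullet> w\<close> (\<open>graphical_derivative_inner_eq_second_subderiv\<close>).
    The inequality of prox-regularity at the points realising \<open>z\<close>, divided by \<open>t\<^sup>2\<close>, passes to the
    limit along recovery sequences of the twice epi-derivative and says that \<open>z\<close> is a proximal
    subgradient of \<open>h/2\<close> at \<open>w\<close>. Since \<open>h\<close> is homogeneous of degree two, comparing \<open>h\<close> at \<open>w\<close>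
    and at \<open>(1 + s) w\<close> with \<open>s \<rightarrow> 0\<close> gives Euler's identity.

  \<^item> If \<open>h\<close> is finite at some nonzero point, then \<open>h\<close> has a smallest eigenvalue: it is lower
    semicontinuous, so on the unit sphere it attains its minimum \<open>l\<close>, at \<open>w\<close> say, and
    \<open>l w \<in> H w\<close> (\<open>eigenvector_in_graphical_derivative\<close>). To find subgradients of \<open>f\<close> itself near
    \<open>xb + t w\<close>, minimise \<open>f\<close> plus a quadratic that makes \<open>w\<close> the only minimiser in the limit, and
    apply Fermat's rule.

  Quadratic growth, positivity of \<open>h\<close> and boundedness of its sublevel set are equivalent by
  compactness of the sphere and homogeneity. The first fact shows that positivity of \<open>h\<close> makes \<open>H\<close>
  positive definite. If \<open>h\<close> is not positive, then \<open>l \<le> 0\<close>, and \<open>l w \<in> H w\<close> with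
  \<open>l w \<bullet> w = l\<close> contradicts positive definiteness. For convex \<open>f\<close> the point \<open>xb\<close> is a global
  minimiser, hence \<open>h \<ge> 0\<close>; if \<open>h\<close> is not positive then \<open>l = 0\<close> and \<open>0 \<in> H w\<close>, so \<open>H\<close> is singular.

  Nonsingularity of \<open>H\<close> gives the KL inequality with exponent \<open>1/2\<close>
  (\<open>KL_half_if_nonsingular\<close>): prox-regularity bounds \<open>f x - f xb\<close> by a multiple of
  \<open>\<parallel>x - xb\<parallel>\<^sup>2\<close> wherever the inequality fails badly, and rescaling a sequence of failures yields
  \<open>0 \<in> H w\<close> with \<open>w \<noteq> 0\<close>. Conversely, along points \<open>xb + t w\<close> with subgradients of size
  \<open>O(t)\<close>, quadratic growth makes \<open>f - f xb\<close> at least of order \<open>t\<^sup>2\<close>, so \<open>t \<ge> c t\<^bsup>2\<theta>\<^esup>\<close>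
  rules out every exponent \<open>\<theta> < 1/2\<close> (\<open>not_KL_below_half\<close>).\<close>

section \<open>Second subderivatives\<close>

lemma second_quotient_le_iff:
  assumes "finite_at f x" "t > 0"
  shows "second_quotient f x v t w \<le> ereal c \<longleftrightarrow>
    f (x + t *\<^sub>R w) \<le> f x + ereal (t * (v \<bullet> w) + c / 2 * t\<^sup>2)"
proof -
  obtain a where a: "f x = ereal a" using assms(1) by (auto simp: finite_at_def)
  show ?thesis
    using assms(2) unfolding second_quotient_def a
    by (cases "f (x + t *\<^sub>R w)") (auto simp: field_simps)
qed

lemma second_quotient_ge_iff:
  assumes "finite_at f x" "t > 0"
  shows "ereal c \<le> second_quotient f x v t w \<longleftrightarrow>
    f x + ereal (t * (v \<bullet> w) + c / 2 * t\<^sup>2) \<le> f (x + t *\<^sub>R w)"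
proof -
  obtain a where a: "f x = ereal a" using assms(1) by (auto simp: finite_at_def)
  show ?thesis
    using assms(2) unfolding second_quotient_def a
    by (cases "f (x + t *\<^sub>R w)") (auto simp: field_simps)
qed

lemma second_quotient_scale:
  assumes "finite_at f x" "t > 0" "s > 0"
  shows "second_quotient f x v t (s *\<^sub>R w) = ereal (s\<^sup>2) * second_quotient f x v (t * s) w"
proof -
  obtain a where a: "f x = ereal a" using assms(1) by (auto simp: finite_at_def)
  show ?thesis
    using assms(2,3) unfolding second_quotient_def a
    by (cases "f (x + (t * s) *\<^sub>R w)") (auto simp: field_simps power2_eq_square)
qed

lemma Liminf_le_filterlim:
  fixes g :: "'b \<Rightarrow> 'c::complete_lattice"
  assumes "filterlim m F G"
  shows "Liminf F g \<le> Liminf G (\<lambda>x. g (m x))"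
proof -
  have "Inf (g ` Collect P) \<le> Liminf G (\<lambda>x. g (m x))" if "eventually P F" for P
  proof (rule Liminf_bounded)
    show "eventually (\<lambda>x. Inf (g ` Collect P) \<le> g (m x)) G"
      using filterlim_iff[THEN iffD1, OF assms, rule_format, OF that]
      by eventually_elim (auto intro: INF_lower)
  qed
  then show ?thesis unfolding Liminf_def[of F] by (auto intro: SUP_least)
qed

lemma filterlim_quotient_filter:
  assumes "\<And>k. t k > (0::real)" "t \<longlonglongrightarrow> 0" "W \<longlonglongrightarrow> w"
  shows "filterlim (\<lambda>k. (t k, W k)) (at_right 0 \<times>\<^sub>F nhds w) sequentially"
  using assms by (intro filterlim_Pair) (auto simp: filterlim_at less_imp_neq[symmetric])

lemma second_subderiv_le_liminf:
  assumes "\<And>k. t k > (0::real)" "t \<longlonglongrightarrow> 0" "W \<longlonglongrightarrow> w"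
  shows "second_subderiv f x v w \<le> liminf (\<lambda>k. second_quotient f x v (t k) (W k))"
  using Liminf_le_filterlim[OF filterlim_quotient_filter[OF assms],
      of "\<lambda>(t, u). second_quotient f x v t u"]
  unfolding second_subderiv_def by simp

lemma second_subderiv_le_lim:
  assumes "\<And>k. t k > (0::real)" "t \<longlonglongrightarrow> 0" "W \<longlonglongrightarrow> w"
    and le: "eventually (\<lambda>k. second_quotient f x v (t k) (W k) \<le> ereal (c k)) sequentially"
    and c: "c \<longlonglongrightarrow> c0"
  shows "second_subderiv f x v w \<le> ereal c0"
proof -
  have "second_subderiv f x v w \<le> liminf (\<lambda>k. second_quotient f x v (t k) (W k))"
    by (rule second_subderiv_le_liminf[OF assms(1-3)])
  also have "\<dots> \<le> liminf (\<lambda>k. ereal (c k))"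
    using le by (rule Liminf_mono)
  also have "\<dots> = ereal c0"
    using c by (intro lim_imp_Liminf) auto
  finally show ?thesis .
qed

text \<open>A lower bound that holds for the quotients on a product of neighbourhoods of \<open>0\<close> and \<open>w\<close>
  bounds the lower limit at every point of the second one.\<close>

lemma second_subderiv_lsc:
  assumes "y < second_subderiv f x v w"
  shows "eventually (\<lambda>u. y < second_subderiv f x v u) (nhds w)"
proof -
  obtain y' where y': "y < y'" "y' < second_subderiv f x v w"
    using assms dense by blast
  have "eventually (\<lambda>(t, u). y' < second_quotient f x v t u) (at_right 0 \<times>\<^sub>F nhds w)"
    using less_LiminfD[OF y'(2)[unfolded second_subderiv_def]] by (simp add: case_prod_beta')
  then obtain P Q where P: "eventually P (at_right 0)" and Q: "eventually Q (nhds w)"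
    and PQ: "\<And>t u. P t \<Longrightarrow> Q u \<Longrightarrow> y' < second_quotient f x v t u"
    unfolding eventually_prod_filter by auto
  show ?thesis
    using eventually_eventually[THEN iffD2, OF Q]
  proof eventually_elim
    case (elim u)
    have "eventually (\<lambda>p. y' \<le> (case p of (t, u) \<Rightarrow> second_quotient f x v t u))
       (at_right 0 \<times>\<^sub>F nhds u)"
      unfolding eventually_prod_filter using P elim PQ
      by (intro exI[of _ P] exI[of _ Q]) (auto intro: less_imp_le)
    then have "y' \<le> second_subderiv f x v u"
      unfolding second_subderiv_def by (rule Liminf_bounded)
    then show ?case using y'(1) by simp
  qed
qed

text \<open>The substitution \<open>(t, u) \<mapsto> (t s, u / s)\<close> maps the approach to \<open>s w\<close> into the approach to
  \<open>w\<close> and multiplies the quotient by \<open>s\<^sup>2\<close>. The opposite inequality follows with \<open>1 / s\<close> for \<open>s\<close>.\<close>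

lemma second_subderiv_scale_ge:
  assumes fin: "finite_at f x" and s: "s > 0"
  shows "ereal (s\<^sup>2) * second_subderiv f x v w \<le> second_subderiv f x v (s *\<^sub>R w)"
proof -
  let ?F = "at_right (0::real) \<times>\<^sub>F nhds (s *\<^sub>R w)"
  let ?m = "\<lambda>(t, u). (t * s, u /\<^sub>R s)"
  let ?Q = "\<lambda>(t, u). second_quotient f x v t u"
  have nb: "?F \<noteq> bot" by (simp add: prod_filter_eq_bot)
  have lim: "filterlim ?m (at_right 0 \<times>\<^sub>F nhds w) ?F"
  proof -
    have 1: "filterlim (\<lambda>p. fst p * s) (at_right 0) ?F"
    proof -
      have "filterlim (\<lambda>t. t * s) (at_right 0) (at_right 0)"
        unfolding filterlim_at
      proof
        show "((\<lambda>t. t * s) \<longlongrightarrow> 0) (at_right 0)"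
          by (auto intro!: tendsto_eq_intros)
        show "eventually (\<lambda>t. t * s \<in> {0<..} \<and> t * s \<noteq> 0) (at_right 0)"
          using eventually_at_right_less[of 0] by eventually_elim (use s in auto)
      qed
      then show ?thesis by (rule filterlim_compose[OF _ filterlim_fst])
    qed
    have "((\<lambda>p. snd p /\<^sub>R s) \<longlongrightarrow> (s *\<^sub>R w) /\<^sub>R s) ?F"
      by (intro tendsto_intros filterlim_snd)
    then have "filterlim (\<lambda>p. snd p /\<^sub>R s) (nhds w) ?F" using s by simp
    with 1 show ?thesis unfolding case_prod_beta' by (rule filterlim_Pair)
  qed
  have "second_subderiv f x v w \<le> Liminf ?F (\<lambda>p. ?Q (?m p))"
    unfolding second_subderiv_def by (rule Liminf_le_filterlim[OF lim])
  then have "ereal (s\<^sup>2) * second_subderiv f x v w \<le> ereal (s\<^sup>2) * Liminf ?F (\<lambda>p. ?Q (?m p))"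
    by (intro ereal_mult_left_mono) auto
  also have "\<dots> = Liminf ?F (\<lambda>p. ereal (s\<^sup>2) * ?Q (?m p))"
    by (rule Liminf_ereal_mult_left[symmetric, OF nb]) simp
  also have "\<dots> = Liminf ?F ?Q"
  proof (rule Liminf_eq)
    have "eventually (\<lambda>p. fst p > 0) ?F"
      using filterlim_fst eventually_at_right_less unfolding filterlim_iff by fast
    then show "eventually (\<lambda>p. ereal (s\<^sup>2) * ?Q (?m p) = ?Q p) ?F"
    proof eventually_elim
      case (elim p)
      then show ?case
        using second_quotient_scale[OF fin elim s, of v "snd p /\<^sub>R s"] s
        by (simp add: case_prod_beta)
    qed
  qed
  finally show ?thesis unfolding second_subderiv_def .
qed

lemma second_subderiv_scale:
  assumes fin: "finite_at f x" and s: "s > 0"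
  shows "second_subderiv f x v (s *\<^sub>R w) = ereal (s\<^sup>2) * second_subderiv f x v w"
proof (rule antisym)
  have "ereal (s\<^sup>2) * (ereal ((inverse s)\<^sup>2) * second_subderiv f x v (s *\<^sub>R w))
     \<le> ereal (s\<^sup>2) * second_subderiv f x v w"
    using second_subderiv_scale_ge[OF fin, of "inverse s" v "s *\<^sub>R w"] s
    by (intro ereal_mult_left_mono) auto
  then show "second_subderiv f x v (s *\<^sub>R w) \<le> ereal (s\<^sup>2) * second_subderiv f x v w"
    using s by (simp add: mult.assoc[symmetric] power_mult_distrib[symmetric] one_ereal_def[symmetric])
qed (rule second_subderiv_scale_ge[OF assms])

text \<open>The constant \<open>c\<close> is positive when this transfers quadratic growth, and \<open>- \<rho>\<close> when it transfers
  the minorant that prox-regularity provides.\<close>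

lemma second_subderiv_ge_quadratic:
  assumes fin: "finite_at f x"
    and ev: "eventually (\<lambda>y. f y \<ge> f x + ereal (c / 2 * (norm (y - x))\<^sup>2)) (nhds x)"
  shows "ereal (c * (norm w)\<^sup>2) \<le> second_subderiv f x 0 w"
proof -
  let ?F = "at_right (0::real) \<times>\<^sub>F nhds w"
  have nb: "?F \<noteq> bot" by (simp add: prod_filter_eq_bot)
  have fst0: "((\<lambda>p. fst p) \<longlongrightarrow> 0) ?F"
    by (rule filterlim_compose[OF _ filterlim_fst]) (simp add: tendsto_ident_at)
  have lim: "((\<lambda>p. x + fst p *\<^sub>R snd p) \<longlongrightarrow> x + 0 *\<^sub>R w) ?F"
    by (intro tendsto_intros fst0 filterlim_snd)
  have pos: "eventually (\<lambda>p. fst p > 0) ?F"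
    using filterlim_fst eventually_at_right_less unfolding filterlim_iff by fast
  have "eventually (\<lambda>p. f (x + fst p *\<^sub>R snd p) \<ge>
      f x + ereal (c / 2 * (norm (x + fst p *\<^sub>R snd p - x))\<^sup>2)) ?F"
    using filterlim_iff[THEN iffD1, OF lim] ev by fastforce
  with pos have "eventually (\<lambda>p. ereal (c * (norm (snd p))\<^sup>2) \<le>
      (case p of (t, u) \<Rightarrow> second_quotient f x 0 t u)) ?F"
    by eventually_elim
      (auto simp: case_prod_beta second_quotient_ge_iff[OF fin] power_mult_distrib mult_ac)
  then have "Liminf ?F (\<lambda>p. ereal (c * (norm (snd p))\<^sup>2)) \<le> second_subderiv f x 0 w"
    unfolding second_subderiv_def by (rule Liminf_mono)
  moreover have "((\<lambda>p. ereal (c * (norm (snd p))\<^sup>2)) \<longlongrightarrow> ereal (c * (norm w)\<^sup>2)) ?F"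
    by (intro tendsto_intros filterlim_snd)
  ultimately show ?thesis
    using lim_imp_Liminf[OF nb] by metis
qed

lemma second_subderiv_zero:
  assumes "finite_at f x"
    and "eventually (\<lambda>y. f y \<ge> f x + ereal (c / 2 * (norm (y - x))\<^sup>2)) (nhds x)"
  shows "second_subderiv f x 0 0 = 0"
proof (rule antisym)
  have "second_subderiv f x 0 0 \<le> ereal 0"
    by (rule second_subderiv_le_lim[of "\<lambda>k. inverse (real (Suc k))" "\<lambda>k. 0" 0 f x 0 "\<lambda>k. 0" 0])
      (use assms(1) LIMSEQ_inverse_real_of_nat in \<open>auto simp: second_quotient_le_iff\<close>)
  then show "second_subderiv f x 0 0 \<le> 0" by (simp add: zero_ereal_def)
  show "0 \<le> second_subderiv f x 0 0"
    using second_subderiv_ge_quadratic[OF assms, of 0] by (simp add: zero_ereal_def)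
qed

text \<open>If growth fails at every rate, the directions of the points where it fails accumulate on the
  unit sphere, at a direction along which the second subderivative is not positive.\<close>

lemma quadratic_growth_iff_second_subderiv_pos:
  fixes f :: "'a::euclidean_space \<Rightarrow> ereal"
  assumes fin: "finite_at f x"
  shows "quadratic_growth f x \<longleftrightarrow> (\<forall>w. w \<noteq> 0 \<longrightarrow> second_subderiv f x 0 w > 0)"
proof
  assume "quadratic_growth f x"
  then obtain \<kappa> where k: "\<kappa> > 0"
    and ev: "eventually (\<lambda>y. f y \<ge> f x + ereal (\<kappa> / 2 * (norm (y - x))\<^sup>2)) (nhds x)"
    unfolding quadratic_growth_def by auto
  show "\<forall>w. w \<noteq> 0 \<longrightarrow> second_subderiv f x 0 w > 0"
  proof (intro allI impI)
    fix w :: 'a assume "w \<noteq> 0"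
    then have "(0::ereal) < ereal (\<kappa> * (norm w)\<^sup>2)" using k by simp
    also have "\<dots> \<le> second_subderiv f x 0 w"
      by (rule second_subderiv_ge_quadratic[OF fin ev])
    finally show "second_subderiv f x 0 w > 0" .
  qed
next
  assume pos: "\<forall>w. w \<noteq> 0 \<longrightarrow> second_subderiv f x 0 w > 0"
  show "quadratic_growth f x"
  proof (rule ccontr)
    assume neg: "\<not> quadratic_growth f x"
    let ?e = "\<lambda>k. inverse (real (Suc k))"
    have "\<exists>y. y \<in> ball x (?e k) \<and> f y < f x + ereal (?e k / 2 * (norm (y - x))\<^sup>2)" for k
    proof (rule ccontr)
      assume "\<not> ?thesis"
      then have *: "\<forall>y\<in>ball x (?e k). f y \<ge> f x + ereal (?e k / 2 * (norm (y - x))\<^sup>2)"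
        by (meson not_less)
      have "eventually (\<lambda>y. y \<in> ball x (?e k)) (nhds x)"
        by (intro eventually_nhds_in_open) auto
      then have "eventually (\<lambda>y. f y \<ge> f x + ereal (?e k / 2 * (norm (y - x))\<^sup>2)) (nhds x)"
        by eventually_elim (use * in blast)
      then show False using neg unfolding quadratic_growth_def
        by (auto simp del: of_nat_Suc dest!: spec[of _ "?e k"])
    qed
    then obtain y where y: "\<And>k. y k \<in> ball x (?e k)"
      and fy: "\<And>k. f (y k) < f x + ereal (?e k / 2 * (norm (y k - x))\<^sup>2)" by metis
    define t where "t k = norm (y k - x)" for k
    define W where "W k = (y k - x) /\<^sub>R t k" for k
    have tpos: "t k > 0" for k
      using fy[of k] by (auto simp: t_def)
    have yk: "y k = x + t k *\<^sub>R W k" for k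
      using tpos[of k] by (simp add: W_def)
    have t0: "t \<longlonglongrightarrow> 0"
      by (rule real_tendsto_sandwich[OF _ _ tendsto_const LIMSEQ_inverse_real_of_nat])
        (use y in \<open>auto simp: t_def dist_norm norm_minus_commute intro!: always_eventually less_imp_le\<close>)
    have "W k \<in> sphere 0 1" for k using tpos[of k] by (simp add: W_def t_def)
    then obtain w r where w: "w \<in> sphere 0 1" and r: "strict_mono r" and lim: "(W \<circ> r) \<longlonglongrightarrow> w"
      using compact_sphere[of "0::'a" 1] unfolding compact_def by meson
    have "second_subderiv f x 0 w \<le> ereal 0"
    proof (rule second_subderiv_le_lim[of "t \<circ> r" "W \<circ> r" _ _ _ _ "?e \<circ> r"])
      show "eventually (\<lambda>k. second_quotient f x 0 ((t \<circ> r) k) ((W \<circ> r) k) \<le> ereal ((?e \<circ> r) k)) sequentially"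
        using fy tpos
        by (simp add: always_eventually second_quotient_le_iff[OF fin] yk[symmetric] less_imp_le flip: t_def)
    qed (use tpos lim LIMSEQ_subseq_LIMSEQ[OF t0 r] 
          LIMSEQ_subseq_LIMSEQ[OF LIMSEQ_inverse_real_of_nat r] in auto)
    moreover have "w \<noteq> 0" using w by auto
    ultimately show False using pos by (auto simp: zero_ereal_def)
  qed
qed

text \<open>If no point of \<open>K\<close> were minimal, each would have a neighbourhood on which \<open>g\<close> exceeds some
  value of \<open>g\<close> on \<open>K\<close>; finitely many neighbourhoods cover \<open>K\<close>, and the point with the smallest of
  these values lies in none of them.\<close>

lemma lsc_attains_inf:
  fixes g :: "'a::topological_space \<Rightarrow> 'b::linorder"
  assumes K: "compact K" "K \<noteq> {}"
    and lsc: "\<And>x y. x \<in> K \<Longrightarrow> y < g x \<Longrightarrow> eventually (\<lambda>u. y < g u) (nhds x)"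
  shows "\<exists>x\<in>K. \<forall>y\<in>K. g x \<le> g y"
proof (rule ccontr)
  assume "\<not> ?thesis"
  then have "\<forall>x\<in>K. \<exists>y\<in>K. g y < g x" by (auto simp: not_le)
  then obtain m where m: "\<And>x. x \<in> K \<Longrightarrow> m x \<in> K" "\<And>x. x \<in> K \<Longrightarrow> g (m x) < g x" by metis
  have "\<forall>x\<in>K. \<exists>U. open U \<and> x \<in> U \<and> (\<forall>u\<in>U. g (m x) < g u)"
    using lsc m(2) unfolding eventually_nhds by blast
  then obtain U where U: "\<And>x. x \<in> K \<Longrightarrow> open (U x)" "\<And>x. x \<in> K \<Longrightarrow> x \<in> U x"
    "\<And>x u. x \<in> K \<Longrightarrow> u \<in> U x \<Longrightarrow> g (m x) < g u" by metis
  obtain D where D: "D \<subseteq> K" "finite D" "K \<subseteq> (\<Union>x\<in>D. U x)"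
    by (rule compactE_image[OF K(1), of K U]) (use U in auto)
  have "D \<noteq> {}" using D K by auto
  then obtain d where d: "d \<in> D" "\<And>x. x \<in> D \<Longrightarrow> g (m d) \<le> g (m x)"
  proof -
    have "Min ((\<lambda>x. g (m x)) ` D) \<in> (\<lambda>x. g (m x)) ` D" using D \<open>D \<noteq> {}\<close> by (intro Min_in) auto
    then obtain d where "d \<in> D" "g (m d) = Min ((\<lambda>x. g (m x)) ` D)" by auto
    then show thesis using D that[of d] by simp
  qed
  have "m d \<in> K" using d D m by auto
  then obtain e where "e \<in> D" "m d \<in> U e" using D by auto
  then show False using U(3)[of e "m d"] d(2)[of e] D(1) by auto
qed

text \<open>This plays the role of the smallest eigenvalue of a quadratic form: \<open>w\<close> minimises over the unit
  sphere, and homogeneity extends the bound to all directions.\<close>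

lemma second_subderiv_min_eigenvalue:
  fixes f :: "'a::euclidean_space \<Rightarrow> ereal"
  assumes fin: "finite_at f x"
    and ev: "eventually (\<lambda>y. f y \<ge> f x + ereal (c / 2 * (norm (y - x))\<^sup>2)) (nhds x)"
    and u: "u \<noteq> 0" "second_subderiv f x 0 u < \<infinity>"
  obtains w l where "norm w = 1" "second_subderiv f x 0 w = ereal l"
    "\<And>u. ereal (l * (norm u)\<^sup>2) \<le> second_subderiv f x 0 u"
proof -
  let ?h = "second_subderiv f x 0"
  have unit: "?h u = ereal ((norm u)\<^sup>2) * ?h (u /\<^sub>R norm u)" if "u \<noteq> 0" for u
    using second_subderiv_scale[OF fin, of "norm u" 0 "u /\<^sub>R norm u"] that by simp
  obtain w where w: "w \<in> sphere 0 1" "\<And>u. u \<in> sphere 0 1 \<Longrightarrow> ?h w \<le> ?h u"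
  proof -
    have "u /\<^sub>R norm u \<in> sphere 0 1" using u(1) by simp
    then have "sphere (0::'a) 1 \<noteq> {}" by blast
    with lsc_attains_inf[OF compact_sphere this second_subderiv_lsc] that show thesis by blast
  qed
  have "?h (u /\<^sub>R norm u) \<noteq> \<infinity>"
    using unit[OF u(1)] u by auto
  then have "?h w \<noteq> \<infinity>" using w(2)[of "u /\<^sub>R norm u"] u(1) by auto
  moreover have "?h w \<noteq> -\<infinity>"
    using second_subderiv_ge_quadratic[OF fin ev, of w] by auto
  ultimately obtain l where l: "?h w = ereal l" by (cases "?h w") auto
  have "ereal (l * (norm u)\<^sup>2) \<le> ?h u" for u
  proof (cases "u = 0")
    case True
    then show ?thesis using second_subderiv_zero[OF fin ev] by simp
  next
    case False
    have "ereal (l * (norm u)\<^sup>2) = ereal ((norm u)\<^sup>2) * ?h w" by (simp add: l)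
    also have "\<dots> \<le> ereal ((norm u)\<^sup>2) * ?h (u /\<^sub>R norm u)"
      using w(2) False by (intro ereal_mult_left_mono) auto
    finally show ?thesis using unit[OF False] by simp
  qed
  then show thesis using that[of w l] w(1) l by auto
qed

text \<open>A nonzero direction in which \<open>h\<close> is not positive spans, by homogeneity, a whole ray in the
  sublevel set.\<close>

lemma second_subderiv_pos_iff_bounded:
  fixes f :: "'a::euclidean_space \<Rightarrow> ereal"
  assumes fin: "finite_at f x"
  shows "(\<forall>w. w \<noteq> 0 \<longrightarrow> second_subderiv f x 0 w > 0) \<longleftrightarrow>
    bounded {w. second_subderiv f x 0 w \<le> 1}" (is "?P \<longleftrightarrow> bounded ?C")
proof
  assume ?P
  then obtain \<kappa> where k: "\<kappa> > 0"
    and ev: "eventually (\<lambda>y. f y \<ge> f x + ereal (\<kappa> / 2 * (norm (y - x))\<^sup>2)) (nhds x)"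
    using quadratic_growth_iff_second_subderiv_pos[OF fin] unfolding quadratic_growth_def by auto
  have "norm w \<le> sqrt (1 / \<kappa>)" if "w \<in> ?C" for w
  proof -
    have "ereal (\<kappa> * (norm w)\<^sup>2) \<le> ereal 1"
      using order_trans[OF second_subderiv_ge_quadratic[OF fin ev, of w], of 1] that
      by (simp add: one_ereal_def)
    then have "(norm w)\<^sup>2 \<le> 1 / \<kappa>" using k by (simp add: field_simps)
    then show ?thesis by (rule real_le_rsqrt)
  qed
  then show "bounded ?C" unfolding bounded_iff by blast
next
  assume "bounded ?C"
  then obtain B where B: "\<And>w. w \<in> ?C \<Longrightarrow> norm w \<le> B" unfolding bounded_iff by blast
  show ?P
  proof (intro allI impI, rule ccontr)
    fix w :: 'a assume w: "w \<noteq> 0" "\<not> 0 < second_subderiv f x 0 w"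
    define s where "s = (\<bar>B\<bar> + 1) / norm w"
    have s: "s > 0" using w by (simp add: s_def add_nonneg_pos)
    have "second_subderiv f x 0 (s *\<^sub>R w) \<le> ereal (s\<^sup>2) * 0"
      unfolding second_subderiv_scale[OF fin s] using w by (intro ereal_mult_left_mono) auto
    then have "s *\<^sub>R w \<in> ?C" by (auto intro: order_trans)
    from B[OF this] show False using w s by (simp add: s_def)
  qed
qed


section \<open>Graphical derivatives and subgradients\<close>

lemma tangent_coneI_eventually:
  assumes "eventually (\<lambda>k. t k > 0 \<and> x + t k *\<^sub>R W k \<in> A) sequentially"
    and "t \<longlonglongrightarrow> 0" "W \<longlonglongrightarrow> w"
  shows "w \<in> tangent_cone A x"
proof -
  obtain N where N: "\<And>k. k \<ge> N \<Longrightarrow> t k > 0 \<and> x + t k *\<^sub>R W k \<in> A"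
    using assms(1) unfolding eventually_sequentially by blast
  show ?thesis unfolding tangent_cone_def
    using N LIMSEQ_ignore_initial_segment[OF assms(2), of N]
      LIMSEQ_ignore_initial_segment[OF assms(3), of N]
    by (intro CollectI exI[of _ "\<lambda>k. t (k + N)"] exI[of _ "\<lambda>k. W (k + N)"]) simp
qed

lemma graphical_derivativeI:
  assumes "eventually (\<lambda>k. t k > 0 \<and> u + t k *\<^sub>R Z k \<in> S (x + t k *\<^sub>R W k)) sequentially"
    and "t \<longlonglongrightarrow> 0" "W \<longlonglongrightarrow> w" "Z \<longlonglongrightarrow> z"
  shows "z \<in> graphical_derivative S x u w"
  unfolding graphical_derivative_def mem_Collect_eq
  by (rule tangent_coneI_eventually[of t _ "\<lambda>k. (W k, Z k)"])
    (use assms in \<open>auto simp: gph_def intro: tendsto_Pair\<close>)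

lemma graphical_derivativeE:
  assumes "z \<in> graphical_derivative S x u w"
  obtains t W Z where "\<And>k. t k > (0::real)" "t \<longlonglongrightarrow> 0" "W \<longlonglongrightarrow> w" "Z \<longlonglongrightarrow> z"
    "\<And>k. u + t k *\<^sub>R Z k \<in> S (x + t k *\<^sub>R W k)"
proof -
  obtain t Y where t: "\<forall>k. t k > (0::real)" "t \<longlonglongrightarrow> 0" and Y: "Y \<longlonglongrightarrow> (w, z)"
    and mem: "\<forall>k. (x, u) + t k *\<^sub>R Y k \<in> gph S"
    using assms unfolding graphical_derivative_def tangent_cone_def by auto
  have "u + t k *\<^sub>R snd (Y k) \<in> S (x + t k *\<^sub>R fst (Y k))" for k
    using mem[rule_format, of k] by (cases "Y k") (auto simp: gph_def)
  then show thesis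
    using that[of t "\<lambda>k. fst (Y k)" "\<lambda>k. snd (Y k)"] t tendsto_fst[OF Y] tendsto_snd[OF Y] by simp
qed

lemma zero_in_graphical_derivative:
  assumes "u \<in> S x"
  shows "0 \<in> graphical_derivative S x u 0"
  by (rule graphical_derivativeI[of "\<lambda>k. inverse (real (Suc k))" _ "\<lambda>k. 0" _ _ "\<lambda>k. 0"])
    (use assms LIMSEQ_inverse_real_of_nat in auto)

lemma regular_subdiff_subset_subdiff: "regular_subdiff f x \<subseteq> subdiff f x"
proof
  fix v assume v: "v \<in> regular_subdiff f x"
  then have "finite_at f x" by (simp add: regular_subdiff_def)
  then show "v \<in> subdiff f x"
    unfolding subdiff_def using v
    by (intro CollectI conjI exI[of _ "\<lambda>k. x"] exI[of _ "\<lambda>k. v"]) auto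
qed

lemma finite_at_subdiff: "v \<in> subdiff f x \<Longrightarrow> finite_at f x"
  by (simp add: subdiff_def)

text \<open>Subdifferential continuity makes the values of \<open>f\<close> converge along a sequence that realises an
  element of the graphical derivative, so that inequalities restricted to points with values near
  \<open>f xb\<close>, such as those of prox-regularity and of the KL property, apply to its late members.\<close>

lemma graphical_derivative_subdiffE:
  assumes sdc: "subdiff_continuous f xb 0" and z: "z \<in> graphical_derivative (subdiff f) xb 0 w"
  obtains t W Z where "\<And>k. t k > (0::real)" "t \<longlonglongrightarrow> 0" "W \<longlonglongrightarrow> w" "Z \<longlonglongrightarrow> z"
    "\<And>k. t k *\<^sub>R Z k \<in> subdiff f (xb + t k *\<^sub>R W k)"
    "(\<lambda>k. xb + t k *\<^sub>R W k) \<longlonglongrightarrow> xb" "(\<lambda>k. t k *\<^sub>R Z k) \<longlonglongrightarrow> 0"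
    "(\<lambda>k. f (xb + t k *\<^sub>R W k)) \<longlonglongrightarrow> f xb"
proof -
  obtain t W Z where t: "\<And>k. t k > 0" "t \<longlonglongrightarrow> 0" and W: "W \<longlonglongrightarrow> w" and Z: "Z \<longlonglongrightarrow> z"
    and mem0: "\<And>k. 0 + t k *\<^sub>R Z k \<in> subdiff f (xb + t k *\<^sub>R W k)"
    by (rule graphical_derivativeE[OF z]) blast
  have mem: "t k *\<^sub>R Z k \<in> subdiff f (xb + t k *\<^sub>R W k)" for k using mem0[of k] by simp
  have X: "(\<lambda>k. xb + t k *\<^sub>R W k) \<longlonglongrightarrow> xb"
    using tendsto_add[OF tendsto_const tendsto_scaleR[OF t(2) W]] by simp
  have V: "(\<lambda>k. t k *\<^sub>R Z k) \<longlonglongrightarrow> 0"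
    using tendsto_scaleR[OF t(2) Z] by simp
  have fX: "(\<lambda>k. f (xb + t k *\<^sub>R W k)) \<longlonglongrightarrow> f xb"
    using sdc X V mem unfolding subdiff_continuous_def by blast
  show thesis by (rule that[OF t W Z mem X V fX])
qed

text \<open>Fermat's rule for the sum of \<open>f\<close> and a smooth function: the Taylor remainder of \<open>q\<close> serves as
  the little-o term.\<close>

lemma fermat_regular_subdiff:
  fixes f :: "'a::euclidean_space \<Rightarrow> ereal" and q :: "'a \<Rightarrow> real"
  assumes fin: "finite_at f x"
    and min: "eventually (\<lambda>y. f x + ereal (q x) \<le> f y + ereal (q y)) (nhds x)"
    and deriv: "(q has_derivative (\<lambda>h. g \<bullet> h)) (at x)"
  shows "- g \<in> regular_subdiff f x"
proof -
  let ?r = "\<lambda>y. q x - q y + g \<bullet> (y - x)"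
  have "((\<lambda>y. (q y - q x - g \<bullet> (y - x)) /\<^sub>R norm (y - x)) \<longlongrightarrow> 0) (at x)"
    using deriv unfolding has_derivative_at_within by (simp add: divide_inverse mult_ac)
  then have "((\<lambda>y. - ((q y - q x - g \<bullet> (y - x)) /\<^sub>R norm (y - x))) \<longlongrightarrow> - 0) (at x)"
    by (rule tendsto_minus)
  then have lim: "((\<lambda>y. ?r y / norm (y - x)) \<longlongrightarrow> 0) (at x)"
    by (simp add: divide_inverse algebra_simps)
  have "?r \<in> o[at x](\<lambda>y. norm (y - x))"
    by (rule smalloI_tendsto[OF lim]) (auto simp: eventually_at_filter)
  moreover have "eventually (\<lambda>y. f y \<ge> f x + ereal (- g \<bullet> (y - x) + ?r y)) (at x)"
  proof -
    obtain a where a: "f x = ereal a" using fin by (auto simp: finite_at_def)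
    have "eventually (\<lambda>y. f y \<ge> f x + ereal (- g \<bullet> (y - x) + ?r y)) (nhds x)"
      using min
    proof eventually_elim
      case (elim y)
      then show ?case unfolding a by (cases "f y") auto
    qed
    then show ?thesis by (auto simp: eventually_at_filter elim: eventually_mono)
  qed
  ultimately show ?thesis
    unfolding regular_subdiff_def using fin by (intro CollectI conjI bexI[of _ ?r])
qed

lemma prox_regularE:
  fixes f :: "'a::euclidean_space \<Rightarrow> ereal"
  assumes "prox_regular f xb vb"
  obtains \<epsilon> \<rho> where "\<epsilon> > 0" "\<rho> \<ge> 0"
    "\<And>x v x'. v \<in> subdiff f x \<Longrightarrow> norm (v - vb) < \<epsilon> \<Longrightarrow> norm (x - xb) < \<epsilon> \<Longrightarrow> f x < f xb + ereal \<epsilon> \<Longrightarrow>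
       x' \<in> cball xb \<epsilon> \<Longrightarrow> f x' \<ge> f x + ereal (v \<bullet> (x' - x) - \<rho> / 2 * (norm (x' - x))\<^sup>2)"
  using assms unfolding prox_regular_def by blast

lemma prox_regular_finite: "prox_regular f xb vb \<Longrightarrow> finite_at f xb"
  by (simp add: prox_regular_def)

text \<open>The inequality of prox-regularity at the base point, for the subgradient \<open>0\<close>.\<close>

lemma prox_regular_quadratic_minorant:
  fixes f :: "'a::euclidean_space \<Rightarrow> ereal"
  assumes "prox_regular f xb 0"
  obtains \<rho> where "\<rho> \<ge> 0"
    "eventually (\<lambda>y. f y \<ge> f xb + ereal (- \<rho> / 2 * (norm (y - xb))\<^sup>2)) (nhds xb)"
proof -
  obtain \<epsilon> \<rho> where e: "\<epsilon> > 0" and r: "\<rho> \<ge> 0" and ineq: "\<And>x v x'. v \<in> subdiff f x \<Longrightarrow>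
      norm (v - 0) < \<epsilon> \<Longrightarrow> norm (x - xb) < \<epsilon> \<Longrightarrow> f x < f xb + ereal \<epsilon> \<Longrightarrow>
      x' \<in> cball xb \<epsilon> \<Longrightarrow> f x' \<ge> f x + ereal (v \<bullet> (x' - x) - \<rho> / 2 * (norm (x' - x))\<^sup>2)"
    by (rule prox_regularE[OF assms]) blast
  have 0: "0 \<in> subdiff f xb" "finite_at f xb" using assms by (auto simp: prox_regular_def)
  have "f xb < f xb + ereal \<epsilon>" using 0(2) e by (cases "f xb") (auto simp: finite_at_def)
  then have *: "f y \<ge> f xb + ereal (- \<rho> / 2 * (norm (y - xb))\<^sup>2)" if "y \<in> ball xb \<epsilon>" for y
    using ineq[OF 0(1), of y] e that by auto
  have "eventually (\<lambda>y. y \<in> ball xb \<epsilon>) (nhds xb)"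
    using e by (intro eventually_nhds_in_open) auto
  from that[OF r eventually_mono[OF this *]] show thesis .
qed

text \<open>Only the part of the epigraph near \<open>(xb, f xb)\<close> is known to be closed. Therefore the minimum is
  taken of the continuous function \<open>(x, r) \<mapsto> r + q x\<close> over the compact set of those points of the
  epigraph that lie over \<open>K\<close> and whose height differs from \<open>f xb\<close> by at most \<open>d\<close>. The last two
  assumptions on \<open>K\<close> and \<open>q\<close> ensure that points outside this height range cannot beat \<open>x0\<close>.\<close>

lemma locally_lsc_minimizer:
  fixes f :: "'a::euclidean_space \<Rightarrow> ereal"
  assumes "locally_lsc_at f xb"
  obtains d where "d > 0" "\<And>K q x0. compact K \<Longrightarrow> K \<subseteq> cball xb d \<Longrightarrow> continuous_on K q \<Longrightarrow> x0 \<in> K \<Longrightarrow>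
      (\<And>x. x \<in> K \<Longrightarrow> f xb - ereal d < f x) \<Longrightarrow>
      (\<And>x. x \<in> K \<Longrightarrow> f x0 + ereal (q x0 - q x) < f xb + ereal d) \<Longrightarrow>
      \<exists>u\<in>K. finite_at f u \<and> (\<forall>x\<in>K. f u + ereal (q u) \<le> f x + ereal (q x))"
proof -
  obtain a where a: "f xb = ereal a"
    using assms by (auto simp: locally_lsc_at_def finite_at_def)
  obtain V where V: "(xb, a) \<in> interior V" "closed (epi f \<inter> V)"
    using assms by (auto simp: locally_lsc_at_def locally_closed_at_def a)
  obtain e where e: "e > 0" "ball (xb, a) e \<subseteq> V"
    using V(1) by (auto simp: mem_interior)
  define d where "d = e / 3"
  have d: "d > 0" using e by (simp add: d_def)
  have box: "cball xb d \<times> {a - d..a + d} \<subseteq> V"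
  proof -
    have "(x, r) \<in> ball (xb, a) e" if "x \<in> cball xb d" "r \<in> {a - d..a + d}" for x r
    proof -
      have "dist (xb, a) (x, r) \<le> dist xb x + dist a r"
        unfolding dist_Pair_Pair by (rule sqrt_sum_squares_le_sum) auto
      also have "\<dots> \<le> d + d" using that by (intro add_mono) (auto simp: dist_real_def)
      also have "\<dots> < e" using e by (simp add: d_def)
      finally show ?thesis by simp
    qed
    then show ?thesis using e by auto
  qed
  show thesis
  proof (rule that[OF d])
    fix K q x0
    assume K: "compact K" "K \<subseteq> cball xb d" and q: "continuous_on K q" and x0: "x0 \<in> K"
      and low: "\<And>x. x \<in> K \<Longrightarrow> f xb - ereal d < f x"
      and up: "\<And>x. x \<in> K \<Longrightarrow> f x0 + ereal (q x0 - q x) < f xb + ereal d"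
    define E where "E = epi f \<inter> (K \<times> {a - d..a + d})"
    have "E = (epi f \<inter> V) \<inter> (K \<times> {a - d..a + d})"
      using box K(2) unfolding E_def by blast
    then have "compact E"
      using closed_Int_compact[OF V(2) compact_Times[OF K(1) compact_Icc]] by simp
    moreover obtain b0 where b0: "f x0 = ereal b0" "a - d < b0" "b0 < a + d"
      using up[OF x0] low[OF x0] unfolding a by (cases "f x0") auto
    then have "(x0, b0) \<in> E" using x0 by (auto simp: E_def epi_def)
    moreover have "continuous_on E (\<lambda>p. snd p + q (fst p))"
      by (intro continuous_intros continuous_on_compose2[OF q]) (auto simp: E_def)
    ultimately obtain p where p: "p \<in> E"
      and pmin: "\<And>p'. p' \<in> E \<Longrightarrow> snd p + q (fst p) \<le> snd p' + q (fst p')"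
      using continuous_attains_inf[of E "\<lambda>p. snd p + q (fst p)"] by blast
    obtain u r where ur: "p = (u, r)" by fastforce
    have u: "u \<in> K" "f u \<le> ereal r" "r \<le> a + d" using p by (auto simp: ur E_def epi_def)
    obtain b where b: "f u = ereal b" using low[OF u(1)] u(2) unfolding a by (cases "f u") auto
    have "f u + ereal (q u) \<le> f x + ereal (q x)" if x: "x \<in> K" for x
    proof (cases "f x \<le> ereal (a + d)")
      case True
      then obtain c where c: "f x = ereal c" using low[OF x] unfolding a by (cases "f x") auto
      then have "(x, c) \<in> E" using True x low[OF x] by (auto simp: E_def epi_def a)
      then have "r + q u \<le> c + q x" using pmin by (fastforce simp: ur)
      then show ?thesis using u(2) by (simp add: b c)
    next
      case False
      have "r + q u \<le> b0 + q x0" using pmin[OF \<open>(x0, b0) \<in> E\<close>] by (simp add: ur)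
      then have "b + q u \<le> a + d + q x" using u(2) up[OF x] by (simp add: b b0 a)
      then show ?thesis using False unfolding b by (cases "f x") auto
    qed
    then show "\<exists>u\<in>K. finite_at f u \<and> (\<forall>x\<in>K. f u + ereal (q u) \<le> f x + ereal (q x))"
      using u(1) b by (intro bexI[of _ u]) (auto simp: finite_at_def)
  qed
qed

text \<open>Prox-regularity at \<open>xb + t k *\<^sub>R W k\<close> compares the difference quotients at \<open>W k\<close> and at a
  recovery sequence for an arbitrary \<open>w'\<close>; the limit is the inequality \<open>key\<close>, a proximal subgradient
  inequality for \<open>h\<close> with subgradient \<open>2 z\<close>. For \<open>w' = 0\<close> it shows that \<open>h w\<close> is finite, and for
  \<open>w' = (1 + s) w\<close> it reads \<open>s b \<le> s\<^sup>2 m\<close>, which forces \<open>b = 0\<close>.\<close>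

lemma graphical_derivative_inner_eq_second_subderiv:
  fixes f :: "'a::euclidean_space \<Rightarrow> ereal"
  assumes prox: "prox_regular f xb 0" and sdc: "subdiff_continuous f xb 0"
    and epi: "twice_epi_differentiable f xb 0"
    and z: "z \<in> graphical_derivative (subdiff f) xb 0 w"
  shows "second_subderiv f xb 0 w = ereal (z \<bullet> w)"
proof -
  let ?h = "second_subderiv f xb 0" and ?Q = "second_quotient f xb 0"
  note fin = prox_regular_finite[OF prox]
  obtain a where a: "f xb = ereal a" using fin by (auto simp: finite_at_def)
  obtain \<rho>' where minor: "eventually (\<lambda>y. f y \<ge> f xb + ereal (- \<rho>' / 2 * (norm (y - xb))\<^sup>2)) (nhds xb)"
    by (rule prox_regular_quadratic_minorant[OF prox])
  obtain \<epsilon> \<rho> where e: "\<epsilon> > 0" and r: "\<rho> \<ge> 0" and ineq: "\<And>x v x'. v \<in> subdiff f x \<Longrightarrow>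
      norm (v - 0) < \<epsilon> \<Longrightarrow> norm (x - xb) < \<epsilon> \<Longrightarrow> f x < f xb + ereal \<epsilon> \<Longrightarrow>
      x' \<in> cball xb \<epsilon> \<Longrightarrow> f x' \<ge> f x + ereal (v \<bullet> (x' - x) - \<rho> / 2 * (norm (x' - x))\<^sup>2)"
    by (rule prox_regularE[OF prox]) blast
  obtain t W Z where t: "\<And>k. t k > 0" "t \<longlonglongrightarrow> 0" and W: "W \<longlonglongrightarrow> w" and Z: "Z \<longlonglongrightarrow> z"
    and mem: "\<And>k. t k *\<^sub>R Z k \<in> subdiff f (xb + t k *\<^sub>R W k)"
    and X: "(\<lambda>k. xb + t k *\<^sub>R W k) \<longlonglongrightarrow> xb" and V: "(\<lambda>k. t k *\<^sub>R Z k) \<longlonglongrightarrow> 0"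
    and fX: "(\<lambda>k. f (xb + t k *\<^sub>R W k)) \<longlonglongrightarrow> f xb"
    by (rule graphical_derivative_subdiffE[OF sdc z]) blast
  have ev1: "eventually (\<lambda>k. norm (t k *\<^sub>R Z k - 0) < \<epsilon>) sequentially"
    using tendstoD[OF V e] by (simp add: dist_norm)
  have ev2: "eventually (\<lambda>k. norm (xb + t k *\<^sub>R W k - xb) < \<epsilon>) sequentially"
    using tendstoD[OF X e] by (simp add: dist_norm)
  have ev3: "eventually (\<lambda>k. f (xb + t k *\<^sub>R W k) < f xb + ereal \<epsilon>) sequentially"
    by (rule order_tendstoD(2)[OF fX]) (simp add: a e)
  have key: "ereal (2 * (z \<bullet> (w' - w)) - \<rho> * (norm (w' - w))\<^sup>2) + ?h w \<le> ?h w'" for w'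
  proof -
    obtain W' where W': "W' \<longlonglongrightarrow> w'" and Q': "(\<lambda>k. ?Q (t k) (W' k)) \<longlonglongrightarrow> ?h w'"
      using epi t unfolding twice_epi_differentiable_def by blast
    define c where "c k = 2 * (Z k \<bullet> (W' k - W k)) - \<rho> * (norm (W' k - W k))\<^sup>2" for k
    have c: "(\<lambda>k. ereal (c k)) \<longlonglongrightarrow> ereal (2 * (z \<bullet> (w' - w)) - \<rho> * (norm (w' - w))\<^sup>2)"
      unfolding c_def by (intro tendsto_intros W W' Z)
    have X': "(\<lambda>k. xb + t k *\<^sub>R W' k) \<longlonglongrightarrow> xb"
      using tendsto_add[OF tendsto_const tendsto_scaleR[OF t(2) W']] by simp
    have ev4: "eventually (\<lambda>k. norm (xb + t k *\<^sub>R W' k - xb) < \<epsilon>) sequentially"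
      using tendstoD[OF X' e] by (simp add: dist_norm)
    have "eventually (\<lambda>k. ereal (c k) + ?Q (t k) (W k) \<le> ?Q (t k) (W' k)) sequentially"
      using ev1 ev2 ev3 ev4
    proof eventually_elim
      case (elim k)
      obtain b where b: "f (xb + t k *\<^sub>R W k) = ereal b"
        using finite_at_subdiff[OF mem, of k] by (auto simp: finite_at_def)
      have "xb + t k *\<^sub>R W' k \<in> cball xb \<epsilon>" using elim(4) by (simp add: dist_norm)
      note sub = ineq[OF mem elim(1-3) this]
      have d: "xb + t k *\<^sub>R W' k - (xb + t k *\<^sub>R W k) = t k *\<^sub>R (W' k - W k)"
        by (simp add: algebra_simps)
      have *: "ereal b + ereal ((t k)\<^sup>2 / 2 * c k) \<le> f (xb + t k *\<^sub>R W' k)"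
        using sub t(1)[of k] unfolding d b norm_scaleR inner_scaleR_left inner_scaleR_right
        by (simp add: c_def power_mult_distrib algebra_simps power2_eq_square)
      have Qk: "?Q (t k) (W k) = ereal ((b - a) / ((t k)\<^sup>2 / 2))"
        using t(1)[of k] by (simp add: second_quotient_def a b)
      have "f xb + ereal (t k * (0 \<bullet> W' k) + (c k + (b - a) / ((t k)\<^sup>2 / 2)) / 2 * (t k)\<^sup>2)
          = ereal b + ereal ((t k)\<^sup>2 / 2 * c k)"
        using t(1)[of k] by (simp add: a field_simps)
      then show ?case
        using * second_quotient_ge_iff[OF fin t(1)[of k], of "c k + (b - a) / ((t k)\<^sup>2 / 2)" 0 "W' k"]
        by (simp add: Qk)
    qed
    then have "liminf (\<lambda>k. ereal (c k) + ?Q (t k) (W k)) \<le> liminf (\<lambda>k. ?Q (t k) (W' k))"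
      by (rule Liminf_mono)
    also have "\<dots> = ?h w'" using Q' by (intro lim_imp_Liminf) auto
    also have "liminf (\<lambda>k. ereal (c k) + ?Q (t k) (W k)) =
       ereal (2 * (z \<bullet> (w' - w)) - \<rho> * (norm (w' - w))\<^sup>2) + liminf (\<lambda>k. ?Q (t k) (W k))"
      by (rule ereal_liminf_lim_add[OF c]) simp
    finally show ?thesis
      using second_subderiv_le_liminf[OF t W, of f xb 0] 
      by (meson add_left_mono order_trans)
  qed
  have "?h w \<noteq> \<infinity>"
    using key[of 0] second_subderiv_zero[OF fin minor] by auto
  moreover have "?h w \<noteq> - \<infinity>"
    using second_subderiv_ge_quadratic[OF fin minor, of w] by auto
  ultimately obtain l where l: "?h w = ereal l" by (cases "?h w") auto
  have main: "s * (2 * (z \<bullet> w) - 2 * l) \<le> s\<^sup>2 * (l + \<rho> * (norm w)\<^sup>2)" if "s > -1" for s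
  proof -
    have "?h ((1 + s) *\<^sub>R w) = ereal ((1 + s)\<^sup>2 * l)"
      using second_subderiv_scale[OF fin, of "1 + s" 0 w] that l by simp
    moreover have "(1 + s) *\<^sub>R w - w = s *\<^sub>R w" by (simp add: algebra_simps)
    ultimately show ?thesis using key[of "(1 + s) *\<^sub>R w"] l
      by (simp add: power_mult_distrib) (simp add: algebra_simps power2_eq_square)
  qed
  define m where "m = l + \<rho> * (norm w)\<^sup>2"
  define b where "b = 2 * (z \<bullet> w) - 2 * l"
  have up: "b \<le> s * m" "- s * m \<le> b" if "0 < s" "s < 1" for s
  proof -
    have "s * b \<le> s * (s * m)" using main[of s] that by (simp add: b_def m_def power2_eq_square)
    then show "b \<le> s * m" using that by simp
    have "- s * b \<le> (- s)\<^sup>2 * m" unfolding b_def m_def by (rule main) (use that in simp)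
    then have "s * (- b) \<le> s * (s * m)"
      by (simp only: power2_eq_square mult_minus_left mult_minus_right minus_minus mult.assoc)
    then have "- b \<le> s * m" using that by (simp only: mult_le_cancel_left_pos)
    then show "- s * m \<le> b" by simp
  qed
  have ev: "eventually (\<lambda>s. 0 < s \<and> s < 1) (at_right (0::real))"
    by (rule eventually_at_rightI[of 0 1]) auto
  have "((\<lambda>s. s * m) \<longlongrightarrow> 0 * m) (at_right 0)" by (intro tendsto_intros)
  from tendsto_lowerbound[OF this eventually_mono[OF ev]] up have "b \<le> 0 * m" by auto
  moreover have "((\<lambda>s. - s * m) \<longlongrightarrow> - 0 * m) (at_right 0)" by (intro tendsto_intros)
  from tendsto_upperbound[OF this eventually_mono[OF ev]] up have "- 0 * m \<le> b" by auto
  ultimately show ?thesis using l by (simp add: b_def)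
qed


text \<open>For small \<open>t\<close> the functions \<open>u \<mapsto> f (xb + t u) + t\<^sup>2 \<phi> u\<close> attain their minimum on the unit ball
  around \<open>w\<close>: the perturbation, the quadratic minorant and the admissible excess \<open>c t\<^sup>2\<close> at \<open>u0\<close> are
  all of order \<open>t\<^sup>2\<close>, so they stay within the height range in which the epigraph is closed.\<close>

lemma eventually_scaled_minimizer:
  fixes f :: "'a::euclidean_space \<Rightarrow> ereal" and \<phi> :: "'a \<Rightarrow> real"
  assumes lsc: "locally_lsc_at f xb"
    and low: "eventually (\<lambda>y. f y \<ge> f xb + ereal (- \<rho> / 2 * (norm (y - xb))\<^sup>2)) (nhds xb)"
    and \<phi>: "continuous_on (cball w 1) \<phi>"
  shows "eventually (\<lambda>t. \<forall>u0\<in>cball w 1. f (xb + t *\<^sub>R u0) \<le> f xb + ereal (c * t\<^sup>2) \<longrightarrow>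
    (\<exists>u\<in>cball w 1. finite_at f (xb + t *\<^sub>R u) \<and>
      (\<forall>v\<in>cball w 1. f (xb + t *\<^sub>R u) + ereal (t\<^sup>2 * \<phi> u) \<le> f (xb + t *\<^sub>R v) + ereal (t\<^sup>2 * \<phi> v))))
    (at_right 0)"
proof -
  obtain a where a: "f xb = ereal a"
    using lsc by (auto simp: locally_lsc_at_def finite_at_def)
  obtain d where d: "d > 0" and mini: "\<And>K q x0. compact K \<Longrightarrow> K \<subseteq> cball xb d \<Longrightarrow> continuous_on K q \<Longrightarrow> x0 \<in> K \<Longrightarrow>
      (\<And>x. x \<in> K \<Longrightarrow> f xb - ereal d < f x) \<Longrightarrow>
      (\<And>x. x \<in> K \<Longrightarrow> f x0 + ereal (q x0 - q x) < f xb + ereal d) \<Longrightarrow>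
      \<exists>u\<in>K. finite_at f u \<and> (\<forall>x\<in>K. f u + ereal (q u) \<le> f x + ereal (q x))"
    by (rule locally_lsc_minimizer[OF lsc]) blast
  have "((\<lambda>y. - \<rho> / 2 * (norm (y - xb))\<^sup>2) \<longlongrightarrow> - \<rho> / 2 * (norm (xb - xb))\<^sup>2) (nhds xb)"
    by (intro tendsto_intros filterlim_ident)
  then have "eventually (\<lambda>y. - d < - \<rho> / 2 * (norm (y - xb))\<^sup>2) (nhds xb)"
    by (rule order_tendstoD) (use d in simp)
  with low have "eventually (\<lambda>y. f xb - ereal d < f y) (nhds xb)"
  proof eventually_elim
    case (elim y)
    then show ?case unfolding a by (cases "f y") auto
  qed
  then obtain e where e: "e > 0" "\<And>y. dist y xb < e \<Longrightarrow> f xb - ereal d < f y"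
    unfolding eventually_nhds_metric by blast
  obtain M where "\<forall>u\<in>cball w 1. \<bar>\<phi> u\<bar> \<le> M"
    using compact_imp_bounded[OF compact_continuous_image[OF \<phi> compact_cball]]
    unfolding bounded_iff by auto
  then have M: "\<bar>\<phi> u\<bar> \<le> M" if "u \<in> cball w 1" for u using that by blast
  have "((\<lambda>t. t * (norm w + 1)) \<longlongrightarrow> 0 * (norm w + 1)) (at_right 0)"
    by (intro tendsto_intros)
  then have ev1: "eventually (\<lambda>t. t * (norm w + 1) < min d e) (at_right 0)"
    by (rule order_tendstoD) (use d e in simp)
  have "((\<lambda>t. (c + 2 * M) * t\<^sup>2) \<longlongrightarrow> (c + 2 * M) * 0\<^sup>2) (at_right 0)"
    by (intro tendsto_intros)
  then have ev2: "eventually (\<lambda>t. (c + 2 * M) * t\<^sup>2 < d) (at_right 0)"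
    by (rule order_tendstoD) (use d in simp)
  show ?thesis
    using ev1 ev2 eventually_at_right_less[of 0]
  proof eventually_elim
    case (elim t)
    define K where "K = (\<lambda>u. xb + t *\<^sub>R u) ` cball w 1"
    define q where "q x = t\<^sup>2 * \<phi> ((x - xb) /\<^sub>R t)" for x
    have q: "q (xb + t *\<^sub>R u) = t\<^sup>2 * \<phi> u" for u using elim(3) by (simp add: q_def)
    have near: "dist (xb + t *\<^sub>R u) xb < min d e" if "u \<in> cball w 1" for u
    proof -
      have "norm u \<le> norm w + norm (u - w)" using norm_triangle_ineq[of w "u - w"] by simp
      also have "\<dots> \<le> norm w + 1" using that by (simp add: dist_norm norm_minus_commute)
      finally have "t * norm u \<le> t * (norm w + 1)" using elim(3) by simp
      from le_less_trans[OF this elim(1)] show ?thesis using elim(3) by (simp add: dist_norm)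
    qed
    have Kc: "compact K" unfolding K_def
      by (intro compact_continuous_image continuous_intros) auto
    have Kd: "K \<subseteq> cball xb d" using near by (fastforce simp: K_def dist_commute)
    have qc: "continuous_on K q" unfolding q_def
      by (intro continuous_intros continuous_on_compose2[OF \<phi>]) (use elim(3) in \<open>auto simp: K_def\<close>)
    have Kl: "f xb - ereal d < f x" if "x \<in> K" for x using that near e(2) by (auto simp: K_def)
    show ?case
    proof (intro ballI impI)
      fix u0 assume u0: "u0 \<in> cball w 1" and le: "f (xb + t *\<^sub>R u0) \<le> f xb + ereal (c * t\<^sup>2)"
      have "f (xb + t *\<^sub>R u0) + ereal (q (xb + t *\<^sub>R u0) - q x) < f xb + ereal d" if xK: "x \<in> K" for x
      proof -
        obtain u where u: "u \<in> cball w 1" "x = xb + t *\<^sub>R u" using xK by (auto simp: K_def)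
        have "t\<^sup>2 * (\<phi> u0 - \<phi> u) \<le> t\<^sup>2 * (2 * M)"
          using M[OF u(1)] M[OF u0] by (intro mult_left_mono) auto
        then have "c * t\<^sup>2 + (t\<^sup>2 * \<phi> u0 - t\<^sup>2 * \<phi> u) < d"
          using elim(2) by (simp add: algebra_simps)
        then show ?thesis using le unfolding u(2) q a by (cases "f (xb + t *\<^sub>R u0)") auto
      qed
      moreover have "xb + t *\<^sub>R u0 \<in> K" using u0 unfolding K_def by (rule imageI)
      ultimately obtain x where "x \<in> K" "finite_at f x" "\<forall>y\<in>K. f x + ereal (q x) \<le> f y + ereal (q y)"
        using mini[OF Kc Kd qc _ Kl] by blast
      then show "\<exists>u\<in>cball w 1. finite_at f (xb + t *\<^sub>R u) \<and>
          (\<forall>v\<in>cball w 1. f (xb + t *\<^sub>R u) + ereal (t\<^sup>2 * \<phi> u) \<le> f (xb + t *\<^sub>R v) + ereal (t\<^sup>2 * \<phi> v))"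
        by (auto simp: K_def q)
    qed
  qed
qed

text \<open>Subgradients of \<open>f\<close> near \<open>xb + t w\<close> come from minimisers \<open>U k\<close> of the difference quotients
  perturbed by \<open>\<phi> u = \<parallel>u - w\<parallel>\<^sup>2 / 2 - l \<parallel>u\<parallel>\<^sup>2 / 2\<close>. A cluster point \<open>u\<close> of them satisfies, by comparison
  with a recovery sequence for \<open>w\<close>, the inequality \<open>h u \<le> l \<parallel>u\<parallel>\<^sup>2 - \<parallel>u - w\<parallel>\<^sup>2\<close>, so minimality of \<open>l\<close>
  leaves only \<open>u = w\<close>. Then the \<open>U k\<close> are interior to the ball, and Fermat's rule
  produces the subgradients \<open>t (l U k - (U k - w))\<close>.\<close>

lemma eigenvector_in_graphical_derivative:
  fixes f :: "'a::euclidean_space \<Rightarrow> ereal"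
  assumes prox: "prox_regular f xb 0" and epi: "twice_epi_differentiable f xb 0"
    and hw: "second_subderiv f xb 0 w = ereal (l * (norm w)\<^sup>2)"
    and min: "\<And>u. ereal (l * (norm u)\<^sup>2) \<le> second_subderiv f xb 0 u"
  shows "l *\<^sub>R w \<in> graphical_derivative (subdiff f) xb 0 w"
proof -
  let ?Q = "second_quotient f xb 0"
  note fin = prox_regular_finite[OF prox]
  obtain a where a: "f xb = ereal a" using fin by (auto simp: finite_at_def)
  obtain \<rho> where minor: "eventually (\<lambda>y. f y \<ge> f xb + ereal (- \<rho> / 2 * (norm (y - xb))\<^sup>2)) (nhds xb)"
    by (rule prox_regular_quadratic_minorant[OF prox])
  define t :: "nat \<Rightarrow> real" where "t k = inverse (real (Suc k))" for k
  have t: "t k > 0" "t \<longlonglongrightarrow> 0" for k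
    using LIMSEQ_inverse_real_of_nat by (auto simp: t_def[abs_def])
  have tr: "filterlim t (at_right 0) sequentially"
    using t by (auto simp: filterlim_at less_imp_neq[symmetric])
  obtain W where W: "W \<longlonglongrightarrow> w" and Q: "(\<lambda>k. ?Q (t k) (W k)) \<longlonglongrightarrow> ereal (l * (norm w)\<^sup>2)"
    using epi t unfolding twice_epi_differentiable_def hw[symmetric] by blast
  define c where "c k = real_of_ereal (?Q (t k) (W k))" for k
  have c: "c \<longlonglongrightarrow> l * (norm w)\<^sup>2"
    using lim_real_of_ereal[OF Q] by (simp add: c_def[abs_def])
  have Qc: "eventually (\<lambda>k. ?Q (t k) (W k) = ereal (c k)) sequentially"
  proof -
    have "eventually (\<lambda>k. ?Q (t k) (W k) < \<infinity>) sequentially"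
      by (rule order_tendstoD[OF Q]) simp
    moreover have "eventually (\<lambda>k. - \<infinity> < ?Q (t k) (W k)) sequentially"
      by (rule order_tendstoD[OF Q]) simp
    ultimately show ?thesis
    proof eventually_elim
      case (elim k)
      then show ?case by (cases "?Q (t k) (W k)") (auto simp: c_def)
    qed
  qed
  define \<phi> where "\<phi> u = (norm (u - w))\<^sup>2 / 2 - l / 2 * (norm u)\<^sup>2" for u
  have \<phi>c: "continuous_on S \<phi>" for S
    unfolding \<phi>_def by (intro continuous_intros) simp_all
  define good where "good k u \<longleftrightarrow> finite_at f (xb + t k *\<^sub>R u) \<and>
    (\<forall>v\<in>cball w 1. f (xb + t k *\<^sub>R u) + ereal ((t k)\<^sup>2 * \<phi> u)
      \<le> f (xb + t k *\<^sub>R v) + ereal ((t k)\<^sup>2 * \<phi> v))" for k u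
  have W1: "eventually (\<lambda>k. W k \<in> cball w 1) sequentially"
    using tendstoD[OF W, of 1] by (auto simp: dist_commute elim: eventually_mono)
  have c1: "eventually (\<lambda>k. c k < l * (norm w)\<^sup>2 + 1) sequentially"
    by (rule order_tendstoD[OF c]) simp
  have lsc: "locally_lsc_at f xb" using prox by (simp add: prox_regular_def)
  have fW: "eventually (\<lambda>k. f (xb + t k *\<^sub>R W k) \<le> f xb + ereal (c k / 2 * (t k)\<^sup>2)) sequentially"
    using Qc
  proof eventually_elim
    case (elim k)
    then show ?case using second_quotient_le_iff[OF fin t(1), of 0 k "W k" "c k"] by simp
  qed
  have "eventually (\<lambda>k. \<exists>u\<in>cball w 1. good k u) sequentially"
    using filterlim_iff[THEN iffD1, OF tr, rule_format,
        OF eventually_scaled_minimizer[OF lsc minor \<phi>c, of w "(l * (norm w)\<^sup>2 + 1) / 2"]] W1 c1 fW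
  proof eventually_elim
    case (elim k)
    have "c k / 2 * (t k)\<^sup>2 \<le> (l * (norm w)\<^sup>2 + 1) / 2 * (t k)\<^sup>2"
      using elim(3) by (intro mult_right_mono) auto
    then have "f (xb + t k *\<^sub>R W k) \<le> f xb + ereal ((l * (norm w)\<^sup>2 + 1) / 2 * (t k)\<^sup>2)"
      using elim(4) unfolding a by (cases "f (xb + t k *\<^sub>R W k)") auto
    with elim(1,2) show ?case unfolding good_def by blast
  qed
  then have ex: "eventually (\<lambda>k. \<exists>u. u \<in> cball w 1 \<and> good k u) sequentially"
    unfolding Bex_def .
  define U where "U k = (if \<exists>u. u \<in> cball w 1 \<and> good k u
    then SOME u. u \<in> cball w 1 \<and> good k u else w)" for k
  have U1: "U k \<in> cball w 1" for k
  proof (cases "\<exists>u. u \<in> cball w 1 \<and> good k u")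
    case True
    from someI_ex[OF this] show ?thesis using True by (simp add: U_def)
  next
    case False
    then show ?thesis unfolding U_def by (subst if_not_P) auto
  qed
  have U: "eventually (\<lambda>k. good k (U k)) sequentially"
    using ex
  proof eventually_elim
    case (elim k)
    from someI_ex[OF elim] show ?case using elim by (auto simp: U_def)
  qed
  obtain u r where r: "strict_mono r" and lim: "(U \<circ> r) \<longlonglongrightarrow> u"
    using compact_cball[of w 1] U1 unfolding compact_def by meson
  have QU: "eventually (\<lambda>k. ?Q (t k) (U k) \<le> ereal (c k + 2 * \<phi> (W k) - 2 * \<phi> (U k))) sequentially"
    using U W1 fW
  proof eventually_elim
    case (elim k)
    obtain b where b: "f (xb + t k *\<^sub>R U k) = ereal b"
      using elim(1) by (auto simp: good_def finite_at_def)
    have "f (xb + t k *\<^sub>R U k) + ereal ((t k)\<^sup>2 * \<phi> (U k))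
        \<le> f (xb + t k *\<^sub>R W k) + ereal ((t k)\<^sup>2 * \<phi> (W k))"
      using elim(1,2) unfolding good_def by blast
    also have "\<dots> \<le> f xb + ereal (c k / 2 * (t k)\<^sup>2) + ereal ((t k)\<^sup>2 * \<phi> (W k))"
      using elim(3) by (rule add_right_mono)
    finally show ?case
      unfolding second_quotient_le_iff[OF fin t(1)] unfolding a b
      by (simp add: field_simps)
  qed
  have "second_subderiv f xb 0 u \<le> ereal (l * (norm w)\<^sup>2 + 2 * \<phi> w - 2 * \<phi> u)"
  proof (rule second_subderiv_le_lim[of "t \<circ> r" "U \<circ> r" u _ _ _
        "(\<lambda>k. c k + 2 * \<phi> (W k) - 2 * \<phi> (U k)) \<circ> r"])
    show "(t \<circ> r) \<longlonglongrightarrow> 0" using LIMSEQ_subseq_LIMSEQ[OF t(2) r] .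
    show "eventually (\<lambda>k. ?Q ((t \<circ> r) k) ((U \<circ> r) k)
        \<le> ereal (((\<lambda>k. c k + 2 * \<phi> (W k) - 2 * \<phi> (U k)) \<circ> r) k)) sequentially"
      using eventually_subseq[OF r QU] by simp
    have "(\<lambda>k. c (r k) + 2 * \<phi> (W (r k)) - 2 * \<phi> (U (r k))) \<longlonglongrightarrow> l * (norm w)\<^sup>2 + 2 * \<phi> w - 2 * \<phi> u"
      using LIMSEQ_subseq_LIMSEQ[OF c r] LIMSEQ_subseq_LIMSEQ[OF W r] lim
      unfolding \<phi>_def o_def by (intro tendsto_intros) simp_all
    then show "((\<lambda>k. c k + 2 * \<phi> (W k) - 2 * \<phi> (U k)) \<circ> r) \<longlonglongrightarrow> l * (norm w)\<^sup>2 + 2 * \<phi> w - 2 * \<phi> u"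
      by (simp add: o_def)
  qed (use t lim in auto)
  then have "ereal (l * (norm u)\<^sup>2) \<le> ereal (l * (norm w)\<^sup>2 + 2 * \<phi> w - 2 * \<phi> u)"
    by (rule order_trans[OF min])
  then have "(norm (u - w))\<^sup>2 \<le> 0" by (simp add: \<phi>_def)
  then have lim: "(U \<circ> r) \<longlonglongrightarrow> w" using lim by simp
  (* The perturbation in the original variable: ?q (xb + t u) = t^2 * phi u. *)
  have sub: "t k *\<^sub>R (l *\<^sub>R U k - (U k - w)) \<in> subdiff f (xb + t k *\<^sub>R U k)"
    if "good k (U k)" "dist (U k) w < 1" for k
  proof -
    let ?q = "\<lambda>y. ((y - (xb + t k *\<^sub>R w)) \<bullet> (y - (xb + t k *\<^sub>R w))) / 2
      - l / 2 * ((y - xb) \<bullet> (y - xb))"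
    have q: "?q y = (t k)\<^sup>2 * \<phi> ((y - xb) /\<^sub>R t k)" for y
    proof -
      define v where "v = (y - xb) /\<^sub>R t k"
      have "y - (xb + t k *\<^sub>R w) = t k *\<^sub>R (v - w)" "y - xb = t k *\<^sub>R v"
        using t(1)[of k] by (simp_all add: v_def algebra_simps)
      note e = this
      have "?q y = (t k)\<^sup>2 * \<phi> v" unfolding e \<phi>_def power2_norm_eq_inner
        by (simp add: power2_eq_square algebra_simps)
      then show ?thesis by (simp add: v_def)
    qed
    have der: "(?q has_derivative (\<lambda>h. (t k *\<^sub>R (U k - w) - l *\<^sub>R (t k *\<^sub>R U k)) \<bullet> h))
       (at (xb + t k *\<^sub>R U k))"
      by (auto intro!: derivative_eq_intros
          simp: algebra_simps inner_commute add_divide_distrib diff_divide_distrib)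
    have "((\<lambda>y. (y - xb) /\<^sub>R t k) \<longlongrightarrow> (xb + t k *\<^sub>R U k - xb) /\<^sub>R t k) (nhds (xb + t k *\<^sub>R U k))"
      by (intro tendsto_intros filterlim_ident)
    then have "((\<lambda>y. (y - xb) /\<^sub>R t k) \<longlongrightarrow> U k) (nhds (xb + t k *\<^sub>R U k))"
      using t(1)[of k] by simp
    from topological_tendstoD[OF this, of "ball w 1"] that(2)
    have "eventually (\<lambda>y. (y - xb) /\<^sub>R t k \<in> ball w 1) (nhds (xb + t k *\<^sub>R U k))"
      by (simp add: dist_commute)
    then have "eventually (\<lambda>y. f (xb + t k *\<^sub>R U k) + ereal (?q (xb + t k *\<^sub>R U k)) \<le> f y + ereal (?q y))
       (nhds (xb + t k *\<^sub>R U k))"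
    proof eventually_elim
      case (elim y)
      have 1: "xb + t k *\<^sub>R ((y - xb) /\<^sub>R t k) = y" "(xb + t k *\<^sub>R U k - xb) /\<^sub>R t k = U k"
        using t(1)[of k] by simp_all
      have "(y - xb) /\<^sub>R t k \<in> cball w 1" using elim by simp
      then have "f (xb + t k *\<^sub>R U k) + ereal ((t k)\<^sup>2 * \<phi> (U k))
        \<le> f (xb + t k *\<^sub>R ((y - xb) /\<^sub>R t k)) + ereal ((t k)\<^sup>2 * \<phi> ((y - xb) /\<^sub>R t k))"
        using that(1) unfolding good_def by blast
      then show ?case unfolding q 1 .
    qed
    from fermat_regular_subdiff[OF _ this der] that(1)
    have "- (t k *\<^sub>R (U k - w) - l *\<^sub>R (t k *\<^sub>R U k)) \<in> subdiff f (xb + t k *\<^sub>R U k)"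
      using regular_subdiff_subset_subdiff unfolding good_def by blast
    then show ?thesis by (simp add: algebra_simps)
  qed
  have near: "eventually (\<lambda>k. dist ((U \<circ> r) k) w < 1) sequentially"
    by (rule tendstoD[OF lim]) simp
  show ?thesis
  proof (rule graphical_derivativeI[of "t \<circ> r" _ "\<lambda>k. l *\<^sub>R (U \<circ> r) k - ((U \<circ> r) k - w)" _ _ "U \<circ> r"])
    show "eventually (\<lambda>k. 0 < (t \<circ> r) k \<and> 0 + (t \<circ> r) k *\<^sub>R (l *\<^sub>R (U \<circ> r) k - ((U \<circ> r) k - w))
        \<in> subdiff f (xb + (t \<circ> r) k *\<^sub>R (U \<circ> r) k)) sequentially"
      using near eventually_subseq[OF r U]
    proof eventually_elim
      case (elim k)
      then show ?case using sub[of "r k"] t(1)[of "r k"] by simp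
    qed
    have "(\<lambda>k. l *\<^sub>R (U \<circ> r) k - ((U \<circ> r) k - w)) \<longlonglongrightarrow> l *\<^sub>R w - (w - w)"
      by (intro tendsto_intros lim)
    then show "(\<lambda>k. l *\<^sub>R (U \<circ> r) k - ((U \<circ> r) k - w)) \<longlonglongrightarrow> l *\<^sub>R w" by simp
  qed (use LIMSEQ_subseq_LIMSEQ[OF t(2) r] lim in auto)
qed

text \<open>If \<open>f y < r < f xb\<close>, convexity makes \<open>f\<close> decrease at least linearly from \<open>xb\<close> towards \<open>y\<close>,
  while the minorant allows only a quadratic decrease.\<close>

lemma convex_fun_global_min:
  fixes f :: "'a::euclidean_space \<Rightarrow> ereal"
  assumes cvx: "convex_fun f" and fin: "finite_at f xb"
    and low: "eventually (\<lambda>y. f y \<ge> f xb + ereal (- \<rho> / 2 * (norm (y - xb))\<^sup>2)) (nhds xb)"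
  shows "f xb \<le> f y"
proof (rule ccontr)
  obtain a where a: "f xb = ereal a" using fin by (auto simp: finite_at_def)
  assume "\<not> f xb \<le> f y"
  then obtain r where r: "f y < ereal r" "r < a"
    using ereal_dense2[of "f y" "f xb"] by (auto simp: a not_le)
  have "((\<lambda>s. xb + s *\<^sub>R (y - xb)) \<longlongrightarrow> xb + 0 *\<^sub>R (y - xb)) (at_right 0)"
    by (intro tendsto_intros)
  then have lim: "filterlim (\<lambda>s. xb + s *\<^sub>R (y - xb)) (nhds xb) (at_right 0)" by simp
  have "eventually (\<lambda>s. 0 < s \<and> s < 1) (at_right (0::real))"
    by (rule eventually_at_rightI[of 0 1]) auto
  with filterlim_iff[THEN iffD1, OF lim, rule_format, OF low]
  have ev: "eventually (\<lambda>s. a - r \<le> s * (\<rho> / 2 * (norm (y - xb))\<^sup>2)) (at_right 0)"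
  proof eventually_elim
    case (elim s)
    have "(1 - s) *\<^sub>R (xb, a) + s *\<^sub>R (y, r) \<in> epi f"
      using cvx elim r unfolding convex_fun_def
      by (intro convexD_alt) (auto simp: epi_def a)
    then have "f (xb + s *\<^sub>R (y - xb)) \<le> ereal (a + s * (r - a))"
      by (simp add: epi_def algebra_simps)
    from order_trans[OF elim(1) this]
    have "ereal a + ereal (- \<rho> / 2 * (norm (s *\<^sub>R (y - xb)))\<^sup>2) \<le> ereal (a + s * (r - a))"
      by (simp add: a)
    then have "s * (a - r) \<le> s * (s * (\<rho> / 2 * (norm (y - xb))\<^sup>2))"
      using elim(2) unfolding norm_scaleR
      by (simp add: power_mult_distrib power2_eq_square algebra_simps)
    then show ?case using elim(2) by simp
  qed
  have "((\<lambda>s. s * (\<rho> / 2 * (norm (y - xb))\<^sup>2)) \<longlongrightarrow> 0 * (\<rho> / 2 * (norm (y - xb))\<^sup>2)) (at_right 0)"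
    by (intro tendsto_intros)
  from tendsto_lowerbound[OF this ev] have "a - r \<le> 0 * (\<rho> / 2 * (norm (y - xb))\<^sup>2)" by simp
  then show False using r by simp
qed

section \<open>The Kurdyka-Lojasiewicz exponent\<close>

text \<open>Points \<open>x\<close> that violate the inequality with constants tending to zero have subgradients \<open>v\<close> with
  \<open>\<parallel>v\<parallel> < \<delta> s\<close>, where \<open>s\<^sup>2 = f x - f xb\<close>. Prox-regularity at \<open>x\<close>, evaluated at \<open>xb\<close>, yields
  \<open>s\<^sup>2 \<le> s t + \<rho> t\<^sup>2 / 2\<close> with \<open>t = \<parallel>x - xb\<parallel>\<close>. Hence \<open>s\<close> is at most \<open>(1 + \<rho>) t\<close>, the quotients
  \<open>v / t\<close> tend to zero, and a cluster point of the unit vectors \<open>(x - xb) / t\<close> is a nonzero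
  zero of the graphical derivative.\<close>

lemma KL_half_if_nonsingular:
  fixes f :: "'a::euclidean_space \<Rightarrow> ereal"
  assumes prox: "prox_regular f xb 0"
    and nonsing: "\<And>w. 0 \<in> graphical_derivative (subdiff f) xb 0 w \<Longrightarrow> w = 0"
  shows "KL_property f xb (1 / 2)"
proof (rule ccontr)
  assume neg: "\<not> KL_property f xb (1 / 2)"
  obtain a where a: "f xb = ereal a" using prox_regular_finite[OF prox] by (auto simp: finite_at_def)
  obtain \<epsilon> \<rho> where e: "\<epsilon> > 0" and r: "\<rho> \<ge> 0" and ineq: "\<And>x v x'. v \<in> subdiff f x \<Longrightarrow>
      norm (v - 0) < \<epsilon> \<Longrightarrow> norm (x - xb) < \<epsilon> \<Longrightarrow> f x < f xb + ereal \<epsilon> \<Longrightarrow>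
      x' \<in> cball xb \<epsilon> \<Longrightarrow> f x' \<ge> f x + ereal (v \<bullet> (x' - x) - \<rho> / 2 * (norm (x' - x))\<^sup>2)"
    by (rule prox_regularE[OF prox]) blast
  (* The failure is tested with radius and height delta k and with mu = delta k / 2, so that
     mu / (1 - 1/2) = delta k; the number s below is the square root of f x - f xb. *)
  define \<delta> :: "nat \<Rightarrow> real" where "\<delta> k = inverse (real (Suc k))" for k
  have \<delta>: "\<delta> k > 0" "\<delta> k \<le> 1" "\<delta> \<longlonglongrightarrow> 0" for k
    using LIMSEQ_inverse_real_of_nat by (auto simp: \<delta>_def[abs_def] inverse_le_1_iff)
  have "\<exists>x s v. norm (x - xb) \<le> \<delta> k \<and> f x = ereal (a + s\<^sup>2) \<and> 0 < s \<and> s\<^sup>2 < \<delta> k \<and>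
      v \<in> subdiff f x \<and> norm v < \<delta> k * s" for k
  proof -
    have "\<not> (\<forall>x. norm (x - xb) \<le> \<delta> k \<and> f xb < f x \<and> f x < f xb + ereal (\<delta> k) \<longrightarrow>
        set_distance 0 (subdiff f x) \<ge>
          ereal (\<delta> k / 2 / (1 - 1 / 2) * (real_of_ereal (f x - f xb)) powr (1 / 2)))"
    proof
      assume "\<forall>x. norm (x - xb) \<le> \<delta> k \<and> f xb < f x \<and> f x < f xb + ereal (\<delta> k) \<longrightarrow>
        set_distance 0 (subdiff f x) \<ge>
          ereal (\<delta> k / 2 / (1 - 1 / 2) * (real_of_ereal (f x - f xb)) powr (1 / 2))"
      moreover have "(0::real) \<le> 1 / 2" "(1 / 2 :: real) < 1" "\<delta> k / 2 > 0" "\<delta> k > 0" "ereal (\<delta> k) > 0"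
        using \<delta>(1)[of k] by simp_all
      ultimately show False using neg unfolding KL_property_def by blast
    qed
    then obtain x where x: "norm (x - xb) \<le> \<delta> k" "f xb < f x" "f x < f xb + ereal (\<delta> k)"
      and "set_distance 0 (subdiff f x) < ereal (\<delta> k * (real_of_ereal (f x - f xb)) powr (1 / 2))"
      by (auto simp: not_le)
    then obtain v where v: "v \<in> subdiff f x"
        "norm v < \<delta> k * (real_of_ereal (f x - f xb)) powr (1 / 2)"
      unfolding set_distance_def by (auto simp: INF_less_iff)
    obtain b where b: "f x = ereal b" using x a by (cases "f x") auto
    show ?thesis
      using x v by (intro exI[of _ x] exI[of _ "sqrt (b - a)"] exI[of _ v])
        (auto simp: a b powr_half_sqrt)
  qed
  then obtain X s V where X: "\<And>k. norm (X k - xb) \<le> \<delta> k" and fX: "\<And>k. f (X k) = ereal (a + (s k)\<^sup>2)"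
    and s: "\<And>k. 0 < s k" "\<And>k. (s k)\<^sup>2 < \<delta> k" and V: "\<And>k. V k \<in> subdiff f (X k)" 
    and nV: "\<And>k. norm (V k) < \<delta> k * s k"
    by metis
  define t where "t k = norm (X k - xb)" for k
  have t: "t k > 0" for k
    using fX[of k] s(1)[of k] a by (auto simp: t_def)
  have t0: "t \<longlonglongrightarrow> 0"
    by (rule real_tendsto_sandwich[OF _ _ tendsto_const \<delta>(3)]) (use X in \<open>auto simp: t_def\<close>)
  have bound: "norm (V k) / t k \<le> (1 + \<rho>) * \<delta> k" if k: "\<delta> k < min \<epsilon> 1" for k
  proof -
    have "s k < 1"
    proof (rule ccontr)
      assume "\<not> s k < 1"
      then have "1 \<le> (s k)\<^sup>2" by simp
      with s(2)[of k] \<delta>(2)[of k] show False by linarith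
    qed
    then have "\<delta> k * s k \<le> \<delta> k" using \<delta>(1)[of k] by (simp add: mult_left_le)
    with nV[of k] k have Ve: "norm (V k - 0) < \<epsilon>" by simp
    have Xe: "norm (X k - xb) < \<epsilon>" using X[of k] k by simp
    have fe: "f (X k) < f xb + ereal \<epsilon>" using s(2)[of k] k by (simp add: fX a)
    have "a + (s k)\<^sup>2 + (V k \<bullet> (xb - X k) - \<rho> / 2 * (norm (xb - X k))\<^sup>2) \<le> a"
      using ineq[OF V Ve Xe fe, of xb] e by (simp add: fX a)
    moreover have "- (V k \<bullet> (xb - X k)) \<le> norm (V k) * t k"
      using norm_cauchy_schwarz[of "V k" "X k - xb"] by (simp add: t_def inner_diff_right)
    moreover have "norm (V k) * t k \<le> s k * t k"
    proof -
      have "\<delta> k * s k \<le> s k" using \<delta>(2)[of k] s(1)[of k] by (simp add: mult_left_le_one_le \<delta>(1) less_imp_le)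
      then show ?thesis using nV[of k] t[of k] by (intro mult_right_mono) auto
    qed
    ultimately have quad: "(s k)\<^sup>2 \<le> s k * t k + \<rho> / 2 * (t k)\<^sup>2"
      by (simp add: t_def norm_minus_commute)
    have "s k \<le> (1 + \<rho>) * t k"
    proof (rule ccontr)
      assume "\<not> ?thesis"
      then have gt: "(1 + \<rho>) * t k < s k" by simp
      have "\<rho> * t k \<ge> 0" using r t[of k] by simp
      with gt have "t k < s k" by (simp add: algebra_simps)
      have "(\<rho> * t k) * t k \<le> (\<rho> * t k) * s k" using \<open>t k < s k\<close> \<open>\<rho> * t k \<ge> 0\<close>
        by (intro mult_left_mono) auto
      moreover have "s k * ((1 + \<rho>) * t k) < s k * s k" using gt s(1)[of k] by simp
      moreover have "0 \<le> \<rho> * (t k)\<^sup>2" using r by simp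
      ultimately show False using quad by (simp add: power2_eq_square algebra_simps)
    qed
    then have "\<delta> k * s k \<le> \<delta> k * ((1 + \<rho>) * t k)"
      using \<delta>(1)[of k] by (intro mult_left_mono) auto
    then show ?thesis using nV[of k] t[of k] by (simp add: field_simps)
  qed
  have Z0: "(\<lambda>k. V k /\<^sub>R t k) \<longlonglongrightarrow> 0"
  proof (rule tendsto_norm_zero_cancel, rule real_tendsto_sandwich[OF _ _ tendsto_const])
    show "(\<lambda>k. (1 + \<rho>) * \<delta> k) \<longlonglongrightarrow> 0" using tendsto_mult_left[OF \<delta>(3)] by fastforce
    have "eventually (\<lambda>k. \<delta> k < min \<epsilon> 1) sequentially"
      by (rule order_tendstoD[OF \<delta>(3)]) (use e in simp)
    then show "eventually (\<lambda>k. norm (V k /\<^sub>R t k) \<le> (1 + \<rho>) * \<delta> k) sequentially"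
    proof eventually_elim
      case (elim k)
      then show ?case using bound[OF elim] t[of k] by (simp add: divide_inverse mult.commute)
    qed
  qed simp
  have "(X k - xb) /\<^sub>R t k \<in> sphere 0 1" for k using t[of k] by (simp add: t_def)
  then obtain w g where w: "w \<in> sphere 0 1" and g: "strict_mono g"
    and lim: "((\<lambda>k. (X k - xb) /\<^sub>R t k) \<circ> g) \<longlonglongrightarrow> w"
    using compact_sphere[of "0::'a" 1, unfolded compact_def, rule_format,
        of "\<lambda>k. (X k - xb) /\<^sub>R t k"] by blast
  have "0 \<in> graphical_derivative (subdiff f) xb 0 w"
    by (rule graphical_derivativeI[of "t \<circ> g" _ "(\<lambda>k. V k /\<^sub>R t k) \<circ> g", OF _ _ lim])
      (use t V LIMSEQ_subseq_LIMSEQ[OF t0 g] LIMSEQ_subseq_LIMSEQ[OF Z0 g] in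
        \<open>auto simp: less_imp_neq[symmetric]\<close>)
  from nonsing[OF this] w show False by simp
qed

text \<open>Along the sequence realising \<open>z\<close>, growth and the KL inequality with exponent \<open>\<theta>\<close> give
  \<open>C t\<^bsup>2\<theta>\<^esup> \<le> t \<parallel>Z k\<parallel>\<close> for a constant \<open>C > 0\<close>; dividing by \<open>t\<^bsup>2\<theta>\<^esup>\<close> leaves a right-hand side
  that tends to zero.\<close>

lemma not_KL_below_half:
  fixes f :: "'a::euclidean_space \<Rightarrow> ereal"
  assumes growth: "quadratic_growth f xb" and sdc: "subdiff_continuous f xb 0"
    and z: "z \<in> graphical_derivative (subdiff f) xb 0 w" and w: "w \<noteq> 0"
    and \<theta>: "0 \<le> \<theta>" "\<theta> < 1 / 2"
  shows "\<not> KL_property f xb \<theta>"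
proof
  assume "KL_property f xb \<theta>"
  then obtain \<mu> \<epsilon> \<nu> where \<mu>: "\<mu> > 0" and \<epsilon>: "\<epsilon> > 0" and \<nu>: "(\<nu>::ereal) > 0"
    and KL: "\<And>x. norm (x - xb) \<le> \<epsilon> \<Longrightarrow> f xb < f x \<Longrightarrow> f x < f xb + \<nu> \<Longrightarrow>
        set_distance 0 (subdiff f x) \<ge>
          ereal (\<mu> / (1 - \<theta>) * (real_of_ereal (f x - f xb)) powr \<theta>)"
    unfolding KL_property_def by blast
  have "0 \<in> subdiff f xb" using sdc by (simp add: subdiff_continuous_def)
  then obtain a where a: "f xb = ereal a"
    using finite_at_subdiff[of 0 f xb] by (auto simp: finite_at_def)
  obtain \<kappa> where \<kappa>: "\<kappa> > 0"
    and gr: "eventually (\<lambda>y. f y \<ge> f xb + ereal (\<kappa> / 2 * (norm (y - xb))\<^sup>2)) (nhds xb)"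
    using growth unfolding quadratic_growth_def by blast
  obtain t W Z where t: "\<And>k. t k > 0" "t \<longlonglongrightarrow> 0" and W: "W \<longlonglongrightarrow> w" and Z: "Z \<longlonglongrightarrow> z"
    and mem: "\<And>k. t k *\<^sub>R Z k \<in> subdiff f (xb + t k *\<^sub>R W k)"
    and X: "(\<lambda>k. xb + t k *\<^sub>R W k) \<longlonglongrightarrow> xb" and V: "(\<lambda>k. t k *\<^sub>R Z k) \<longlonglongrightarrow> 0"
    and fX: "(\<lambda>k. f (xb + t k *\<^sub>R W k)) \<longlonglongrightarrow> f xb"
    by (rule graphical_derivative_subdiffE[OF sdc z]) blast
  have ev1: "eventually (\<lambda>k. norm (xb + t k *\<^sub>R W k - xb) < \<epsilon>) sequentially"
    using tendstoD[OF X \<epsilon>] by (simp add: dist_norm)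
  have ev2: "eventually (\<lambda>k. f (xb + t k *\<^sub>R W k) < f xb + \<nu>) sequentially"
    by (rule order_tendstoD(2)[OF fX]) (use \<nu> in \<open>cases \<nu>; simp add: a\<close>)
  have ev3: "eventually (\<lambda>k. norm w / 2 < norm (W k)) sequentially"
    by (rule order_tendstoD(1)[OF tendsto_norm[OF W]]) (use w in simp)
  define C where "C = \<mu> / (1 - \<theta>) * (\<kappa> / 2 * (norm w / 2)\<^sup>2) powr \<theta>"
  have C: "C > 0" using \<mu> \<theta> \<kappa> w by (simp add: C_def)
  have "eventually (\<lambda>k. C \<le> t k powr (1 - 2 * \<theta>) * norm (Z k)) sequentially"
    using ev1 ev2 ev3 filterlim_iff[THEN iffD1, OF X, rule_format, OF gr]
  proof eventually_elim
    case (elim k)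
    let ?x = "xb + t k *\<^sub>R W k"
    obtain b where b: "f ?x = ereal b"
      using finite_at_subdiff[OF mem, of k] by (auto simp: finite_at_def)
    have "\<kappa> / 2 * (t k * (norm w / 2))\<^sup>2 \<le> \<kappa> / 2 * (t k * norm (W k))\<^sup>2"
      using elim(3) \<kappa> t(1)[of k] by (intro mult_left_mono power_mono) auto
    also have "\<dots> \<le> b - a" using elim(4) t(1)[of k] by (simp add: a b power_mult_distrib)
    also have "\<kappa> / 2 * (t k * (norm w / 2))\<^sup>2 = \<kappa> / 2 * (norm w / 2)\<^sup>2 * (t k)\<^sup>2"
      by (simp only: power_mult_distrib mult_ac)
    finally have ba: "\<kappa> / 2 * (norm w / 2)\<^sup>2 * (t k)\<^sup>2 \<le> b - a" .
    have p: "0 < \<kappa> / 2 * (norm w / 2)\<^sup>2 * (t k)\<^sup>2" using \<kappa> w t(1)[of k] by simp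
    have tp: "t k powr (2 * \<theta>) = ((t k)\<^sup>2) powr \<theta>"
      using t(1)[of k] by (simp add: powr_powr flip: powr_numeral)
    have "C * t k powr (2 * \<theta>) = \<mu> / (1 - \<theta>) * (\<kappa> / 2 * (norm w / 2)\<^sup>2 * (t k)\<^sup>2) powr \<theta>"
      using \<kappa> unfolding tp C_def by (subst (2) powr_mult) auto
    also have "\<dots> \<le> \<mu> / (1 - \<theta>) * (b - a) powr \<theta>"
      using \<mu> \<theta> p ba by (intro mult_left_mono powr_mono2) auto
    also have "ereal \<dots> \<le> set_distance 0 (subdiff f ?x)"
      using KL[of ?x] elim(1,2) p ba by (simp add: a b)
    also have "\<dots> \<le> ereal (norm (t k *\<^sub>R Z k))"
      unfolding set_distance_def by (rule INF_lower2[OF mem]) simp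
    finally have "C * t k powr (2 * \<theta>) \<le> t k * norm (Z k)" using t(1)[of k] by simp
    also have "t k * norm (Z k) = t k powr (1 - 2 * \<theta>) * norm (Z k) * t k powr (2 * \<theta>)"
      using t(1)[of k] by (simp add: powr_diff)
    finally show ?case using t(1)[of k] by simp
  qed
  moreover have "(\<lambda>k. t k powr (1 - 2 * \<theta>) * norm (Z k)) \<longlonglongrightarrow> 0 powr (1 - 2 * \<theta>) * norm z"
    by (intro tendsto_intros tendsto_powr' t Z) (use \<theta> t(1) in \<open>auto simp: less_imp_le\<close>)
  ultimately have "C \<le> 0 powr (1 - 2 * \<theta>) * norm z"
    by (intro tendsto_lowerbound) auto
  then show False using C by simp
qed

section \<open>Equivalence of the second-order conditions\<close>

theorem corollary4p7:
  fixes f :: "real ^ 'n \<Rightarrow> ereal" and xb :: "real ^ 'n"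
  assumes "prox_regular f xb 0"
    and "subdiff_continuous f xb 0"
    and "twice_epi_differentiable f xb 0"
  shows "let H = graphical_derivative (subdiff f) xb 0;
             C = {w. second_subderiv f xb 0 w \<le> 1};
             i = quadratic_growth f xb;
             ii = (\<forall>w. w \<noteq> 0 \<longrightarrow> second_subderiv f xb 0 w > 0);
             iii = bounded C;
             iv = pos_definite_map H;
             v = (inverse_map H 0 = {0})
         in (i \<longleftrightarrow> ii) \<and> (ii \<longleftrightarrow> iii) \<and> (iii \<longleftrightarrow> iv) \<and> (iv \<longrightarrow> v) \<and>
            (convex_fun f \<longrightarrow> (i \<longleftrightarrow> ii) \<and> (ii \<longleftrightarrow> iii) \<and> (iii \<longleftrightarrow> iv) \<and> (iv \<longleftrightarrow> v)) \<and>
            (i \<or> ii \<or> iii \<or> iv \<longrightarrow>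
               KL_property f xb (1 / 2) \<and>
               (dom_map H \<noteq> {0} \<longleftrightarrow> C \<noteq> {0}) \<and>
               (dom_map H \<noteq> {0} \<longrightarrow> KL_sharp f xb (1 / 2)))"
proof -
  let ?h = "second_subderiv f xb 0"
  let ?H = "graphical_derivative (subdiff f) xb 0"
  let ?C = "{w. ?h w \<le> 1}"
  let ?ii = "\<forall>w. w \<noteq> 0 \<longrightarrow> ?h w > 0"
  note prox = assms(1) and sdc = assms(2) and epi = assms(3)
  note fin = prox_regular_finite[OF prox]
  obtain \<rho> where minor: "eventually (\<lambda>y. f y \<ge> f xb + ereal (- \<rho> / 2 * (norm (y - xb))\<^sup>2)) (nhds xb)"
    by (rule prox_regular_quadratic_minorant[OF prox])
  note h_eq = graphical_derivative_inner_eq_second_subderiv[OF prox sdc epi]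
  have H0: "0 \<in> ?H 0"
    using prox by (intro zero_in_graphical_derivative) (simp add: prox_regular_def)
  have h0: "?h 0 = 0" by (rule second_subderiv_zero[OF fin minor])

  have eigen: "\<exists>w l. norm w = 1 \<and> l *\<^sub>R w \<in> ?H w \<and> (\<forall>u. ereal (l * (norm u)\<^sup>2) \<le> ?h u)"
    if u: "u \<noteq> 0" "?h u < \<infinity>" for u
  proof -
    obtain w l where w: "norm w = 1" "?h w = ereal l" "\<And>u. ereal (l * (norm u)\<^sup>2) \<le> ?h u"
      using second_subderiv_min_eigenvalue[OF fin minor u] by blast
    then have "l *\<^sub>R w \<in> ?H w"
      by (intro eigenvector_in_graphical_derivative[OF prox epi]) auto
    then show ?thesis using w by blast
  qed

  have i_ii: "quadratic_growth f xb \<longleftrightarrow> ?ii"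
    by (rule quadratic_growth_iff_second_subderiv_pos[OF fin])
  have ii_iii: "?ii \<longleftrightarrow> bounded ?C"
    by (rule second_subderiv_pos_iff_bounded[OF fin])
  have ii_iv: "?ii \<longleftrightarrow> pos_definite_map ?H"
  proof
    assume ?ii
    then show "pos_definite_map ?H" unfolding pos_definite_map_def
      using h_eq by fastforce
  next
    assume pd: "pos_definite_map ?H"
    show ?ii
    proof (intro allI impI, rule ccontr)
      fix u :: "real ^ 'n" assume u: "u \<noteq> 0" "\<not> 0 < ?h u"
      then have "?h u < \<infinity>" by auto
      from eigen[OF u(1) this] obtain w l where w: "norm w = 1" "l *\<^sub>R w \<in> ?H w"
        and l: "\<forall>u. ereal (l * (norm u)\<^sup>2) \<le> ?h u" by blast
      have "ereal (l * (norm u)\<^sup>2) \<le> ereal 0"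
        using order_trans[OF l[rule_format, of u], of 0] u(2) by (simp add: not_less)
      then have "l \<le> 0" using u(1) by (simp add: mult_le_0_iff)
      moreover have "w \<noteq> 0" using w(1) by auto
      with w have "l *\<^sub>R w \<bullet> w > 0"
        using pd unfolding pos_definite_map_def by blast
      ultimately show False using w(1) by (simp add: dot_square_norm)
    qed
  qed
  have iv_v: "inverse_map ?H 0 = {0}" if "pos_definite_map ?H"
    using that H0 unfolding pos_definite_map_def inverse_map_def by force
  have v_ii: ?ii if v: "inverse_map ?H 0 = {0}" and cvx: "convex_fun f"
  proof (intro allI impI, rule ccontr)
    fix u :: "real ^ 'n" assume u: "u \<noteq> 0" "\<not> 0 < ?h u"
    have "eventually (\<lambda>y. f y \<ge> f xb + ereal (0 / 2 * (norm (y - xb))\<^sup>2)) (nhds xb)"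
      using convex_fun_global_min[OF cvx fin minor] by (intro always_eventually) simp
    from second_subderiv_ge_quadratic[OF fin this]
    have nonneg: "ereal (0 * (norm u)\<^sup>2) \<le> ?h u" for u .
    with u(2) have "?h u = ereal (0 * (norm u)\<^sup>2)"
      by (simp add: not_less antisym flip: zero_ereal_def)
    from eigenvector_in_graphical_derivative[OF prox epi this nonneg]
    have "u \<in> inverse_map ?H 0" by (simp add: inverse_map_def)
    with v u(1) show False by simp
  qed
  have KL: "KL_property f xb (1 / 2)" if "inverse_map ?H 0 = {0}"
    by (rule KL_half_if_nonsingular[OF prox]) (use that in \<open>auto simp: inverse_map_def\<close>)
  have dom_C: "dom_map ?H \<noteq> {0} \<longleftrightarrow> ?C \<noteq> {0}" if ii: ?ii
  proof -
    have "dom_map ?H \<noteq> {0} \<longleftrightarrow> (\<exists>w z. w \<noteq> 0 \<and> z \<in> ?H w)"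
      using H0 by (auto simp: dom_map_def)
    also have "\<dots> \<longleftrightarrow> (\<exists>u. u \<noteq> 0 \<and> ?h u \<le> 1)"
    proof
      assume "\<exists>w z. w \<noteq> 0 \<and> z \<in> ?H w"
      then obtain w z where w: "w \<noteq> 0" "?h w = ereal (z \<bullet> w)" using h_eq by blast
      then have p: "z \<bullet> w > 0" using ii by fastforce
      define s where "s = 1 / sqrt (z \<bullet> w)"
      have s: "s > 0" using p by (simp add: s_def)
      have "?h (s *\<^sub>R w) = 1"
        unfolding second_subderiv_scale[OF fin s] w(2)
        using p by (simp add: s_def power_divide one_ereal_def)
      then show "\<exists>u. u \<noteq> 0 \<and> ?h u \<le> 1" using w(1) s by (intro exI[of _ "s *\<^sub>R w"]) simp
    next
      assume "\<exists>u. u \<noteq> 0 \<and> ?h u \<le> 1"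
      then obtain u where u: "u \<noteq> 0" "?h u \<le> 1" by blast
      then have "?h u < \<infinity>" by (auto intro: le_less_trans)
      from eigen[OF u(1) this] obtain w l where w: "norm w = 1" "l *\<^sub>R w \<in> ?H w" by blast
      then have "w \<noteq> 0" by auto
      with w(2) show "\<exists>w z. w \<noteq> 0 \<and> z \<in> ?H w" by blast
    qed
    also have "\<dots> \<longleftrightarrow> ?C \<noteq> {0}" using h0 by auto
    finally show ?thesis .
  qed
  have sharp: "KL_sharp f xb (1 / 2)" if ii: ?ii and dom: "dom_map ?H \<noteq> {0}"
  proof -
    obtain w z where w: "w \<noteq> 0" "z \<in> ?H w" using dom H0 by (auto simp: dom_map_def)
    have "quadratic_growth f xb" using ii i_ii by blast
    from not_KL_below_half[OF this sdc w(2,1)] KL iv_v ii ii_iv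
    show ?thesis unfolding KL_sharp_def by auto
  qed
  have convex: "convex_fun f \<longrightarrow> (pos_definite_map ?H \<longleftrightarrow> inverse_map ?H 0 = {0})"
    using v_ii iv_v ii_iv by (intro impI iffI) simp_all
  have "?ii \<longrightarrow> KL_property f xb (1 / 2) \<and> (dom_map ?H \<noteq> {0} \<longleftrightarrow> ?C \<noteq> {0}) \<and>
      (dom_map ?H \<noteq> {0} \<longrightarrow> KL_sharp f xb (1 / 2))"
    using KL iv_v ii_iv dom_C sharp by (intro impI conjI) simp_all
  then show ?thesis
    unfolding Let_def i_ii ii_iii[symmetric] ii_iv[symmetric]
    using convex iv_v unfolding ii_iv[symmetric] by satx
qed

end
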